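(* There is a deterministic online exploration algorithm with advice that, for every tadpole graph $G$ with positive edge weights and every starting vertex $s$, given a suitable advice string of 2 bits, explores $G$ with cost at most $\frac{1+\sqrt{3}}{2}\cdot\mathrm{cost}_{\mathrm{opt}}(G,s)$.
   Context: A tadpole graph is a connected undirected graph consisting of a cycle (at least 3 vertices) together with a path (the stem, at least 1 vertex), one endpoint of which is joined by an edge to one cycle vertex (the junction); exactly one vertex has degree 1, exactly one has degree 3, others degree 2. Each edge $e$ has positive weight $c(e)$. Online exploration model: vertices have unique identifiers; a searcher starts at $s$ knowing only $s$; upon arriving at $v$ it learns identifiers of all neighbours of $v$ and weights of all incident edges; each edge traversal costs its weight; the searcher must perform a closed walk from $s$ visiting all vertices. $\mathrm{cost}_{\mathrm{opt}}(G,s)$ is the minimum cost of such a closed walk. Advice model: before the exploration starts, an oracle that knows the entire graph, the starting vertex and the (deterministic) algorithm gives the searcher a bit string (the advice), which the algorithm may use in its decisions. *)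

theory Defs
  imports Complex_Main
begin

record 'v wgraph =
  verts :: "'v set"
  edges :: "'v set set"
  weight :: "'v set \<Rightarrow> real"

definition path_edges :: "'v list \<Rightarrow> 'v set set" where
  "path_edges xs = {{xs ! i, xs ! Suc i} | i. Suc i < length xs}"

definition cycle_edges :: "'v list \<Rightarrow> 'v set set" where
  "cycle_edges xs = insert {last xs, hd xs} (path_edges xs)"

text \<open>\<open>cs\<close> lists the cycle in cyclic order, \<open>ps\<close> the stem from the
  junction outwards, and \<open>j\<close> is the junction.\<close>
definition tadpole :: "'v wgraph \<Rightarrow> bool" where
  "tadpole G \<longleftrightarrow> (\<exists>cs ps j.
     3 \<le> length cs \<and> 1 \<le> length ps \<and> distinct (cs @ ps) \<and> j \<in> set cs \<and>
     verts G = set cs \<union> set ps \<and>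
     edges G = cycle_edges cs \<union> path_edges ps \<union> {{j, hd ps}})"

definition positive_weights :: "'v wgraph \<Rightarrow> bool" where
  "positive_weights G \<longleftrightarrow> (\<forall>e \<in> edges G. 0 < weight G e)"

definition walk :: "'v wgraph \<Rightarrow> 'v list \<Rightarrow> bool" where
  "walk G w \<longleftrightarrow> w \<noteq> [] \<and> set w \<subseteq> verts G \<and> path_edges w \<subseteq> edges G"

definition walk_cost :: "'v wgraph \<Rightarrow> 'v list \<Rightarrow> real" where
  "walk_cost G w = (\<Sum>i < length w - 1. weight G {w ! i, w ! Suc i})"

definition exploration_tour :: "'v wgraph \<Rightarrow> 'v \<Rightarrow> 'v list \<Rightarrow> bool" where
  "exploration_tour G s w \<longleftrightarrow> walk G w \<and> hd w = s \<and> last w = s \<and> set w = verts G"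

text \<open>The infimum is a minimum for finite graphs with positive weights; see
  \<open>cost_opt_attained\<close> below.\<close>
definition cost_opt :: "'v wgraph \<Rightarrow> 'v \<Rightarrow> real" where
  "cost_opt G s = Inf (walk_cost G ` {w. exploration_tour G s w})"

text \<open>What the searcher learns on arriving at \<open>v\<close>: the identifier of \<open>v\<close>, and a
  partial map whose domain is the set of neighbours of \<open>v\<close> and whose values are the
  weights of the corresponding incident edges.\<close>
type_synonym 'v observation = "'v \<times> ('v \<rightharpoonup> real)"

definition observe :: "'v wgraph \<Rightarrow> 'v \<Rightarrow> 'v observation" where
  "observe G v = (v, \<lambda>u. if {v, u} \<in> edges G then Some (weight G {v, u}) else None)"

text \<open>A deterministic algorithm maps the advice string and the observations made so
  far, in chronological order, to the next vertex to move to, or to \<open>None\<close> to halt.\<close>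
type_synonym 'v explorer = "bool list \<Rightarrow> 'v observation list \<Rightarrow> 'v option"

text \<open>A move to a vertex that is not a neighbour of the current one is illegal: the
  execution is then stuck and never halts.\<close>
inductive execution :: "'v explorer \<Rightarrow> bool list \<Rightarrow> 'v wgraph \<Rightarrow> 'v \<Rightarrow> 'v list \<Rightarrow> bool"
  for A :: "'v explorer" and b :: "bool list" and G :: "'v wgraph" and s :: 'v where
  start: "execution A b G s [s]"
| move: "\<lbrakk>execution A b G s w; A b (map (observe G) w) = Some u; {last w, u} \<in> edges G\<rbrakk>
    \<Longrightarrow> execution A b G s (w @ [u])"

definition halts_with :: "'v explorer \<Rightarrow> bool list \<Rightarrow> 'v wgraph \<Rightarrow> 'v \<Rightarrow> 'v list \<Rightarrow> bool" where
  "halts_with A b G s w \<longleftrightarrow> execution A b G s w \<and> A b (map (observe G) w) = None"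

definition explores_with_cost_le ::
  "'v explorer \<Rightarrow> bool list \<Rightarrow> 'v wgraph \<Rightarrow> 'v \<Rightarrow> real \<Rightarrow> bool" where
  "explores_with_cost_le A b G s k \<longleftrightarrow>
     (\<exists>w. halts_with A b G s w \<and> exploration_tour G s w \<and> walk_cost G w \<le> k)"

lemma walk_cost_ge:
  assumes "walk G w" "\<And>e. e \<in> edges G \<Longrightarrow> d \<le> weight G e"
  shows "real (length w - 1) * d \<le> walk_cost G w"
proof -
  have "(\<Sum>i < length w - 1. d) \<le> walk_cost G w"
    unfolding walk_cost_def
  proof (rule sum_mono)
    fix i assume "i \<in> {..<length w - 1}"
    then have "{w ! i, w ! Suc i} \<in> path_edges w"
      by (auto simp: path_edges_def)
    then show "d \<le> weight G {w ! i, w ! Suc i}"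
      using assms by (auto simp: walk_def)
  qed
  then show ?thesis by simp
qed

lemma cost_opt_attained:
  assumes fin: "finite (verts G)" "finite (edges G)" and pos: "positive_weights G"
    and tour: "exploration_tour G s w0"
  shows "\<exists>w. exploration_tour G s w \<and> walk_cost G w = cost_opt G s"
proof -
  define d where "d = Min (insert 1 (weight G ` edges G))"
  have d: "0 < d" "\<And>e. e \<in> edges G \<Longrightarrow> d \<le> weight G e"
    using fin pos by (auto simp: d_def positive_weights_def)
  define K where "K = nat \<lceil>walk_cost G w0 / d\<rceil> + 1"
  define T where "T = {w. exploration_tour G s w \<and> length w \<le> K}"
  have "T \<subseteq> {w. set w \<subseteq> verts G \<and> length w \<le> K}"
    by (auto simp: T_def exploration_tour_def)
  then have finT: "finite T"
    using finite_lists_length_le[OF fin(1)] finite_subset by blast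
  have short: "w \<in> T" if w: "exploration_tour G s w" "walk_cost G w \<le> walk_cost G w0" for w
  proof -
    have "real (length w - 1) * d \<le> walk_cost G w0"
      using walk_cost_ge[of G w d] w d(2) by (auto simp: exploration_tour_def)
    then have "real (length w - 1) \<le> walk_cost G w0 / d"
      using d(1) by (simp add: field_simps)
    then have "length w - 1 \<le> nat \<lceil>walk_cost G w0 / d\<rceil>" by linarith
    then show ?thesis using w by (auto simp: T_def K_def)
  qed
  have w0: "w0 \<in> T" using short tour by simp
  define m where "m = Min (walk_cost G ` T)"
  have "m \<in> walk_cost G ` T" unfolding m_def using finT w0 by (intro Min_in) auto
  then obtain w where w: "w \<in> T" "walk_cost G w = m" by auto
  have le: "m \<le> walk_cost G v" if "exploration_tour G s v" for v
  proof (cases "walk_cost G v \<le> walk_cost G w0")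
    case True
    then show ?thesis using short that finT by (auto simp: m_def)
  next
    case False
    have "m \<le> walk_cost G w0" using w0 finT by (auto simp: m_def)
    then show ?thesis using False by simp
  qed
  have "cost_opt G s = m"
    unfolding cost_opt_def
    by (rule cInf_eq_minimum) (use w le in \<open>auto simp: T_def\<close>)
  then show ?thesis using w by (auto simp: T_def)
qed

lemma execution_nonempty: "execution A b G s w \<Longrightarrow> w \<noteq> []"
  by (induction rule: execution.induct) auto

lemma execution_unique:
  assumes "execution A b G s w" "execution A b G s w'" "length w = length w'"
  shows "w = w'"
  using assms
proof (induction arbitrary: w' rule: execution.induct)
  case start
  from start(1) show ?case using start(2) by cases (auto dest: execution_nonempty)
next
  case (move w u)
  from move.prems(1) show ?case
  proof cases
    case start
    then show ?thesis using execution_nonempty[OF move.hyps(1)] move.prems(2) by simp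
  next
    case (move v x)
    then show ?thesis using \<open>length (w @ [u]) = length w'\<close> move.IH move.hyps by auto
  qed
qed

end

theory Submission
  imports Defs
begin

text \<open>Two bits suffice to tell the stem apart from the cycle. At a start of degree 3 they name the
  stem edge. At a start of degree 2 the first bit says whether it lies on the stem; the second then
  names the direction of the leaf, or, for a start on the cycle, which of the two new edges at the
  junction is the stem edge. So the stem costs exactly twice its length \<open>P\<close>, and it remains to explore
  a cycle of length \<open>C\<close> online without advice.

  The searcher extends an explored arc around a base vertex. Let \<open>r\<close> and \<open>l\<close> be the distances from its
  two ends to the base, the searcher being at the first, \<open>c\<close> and \<open>a\<close> the weights of the unexplored edges
  there, and \<open>E + r\<close> the cost so far. It crosses the near edge if \<open>E + c \<le> sqrt 3 * (r + l + a)\<close>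
  and otherwise turns round and crosses the far one, which increases \<open>E\<close> by \<open>2 * r\<close>. The threshold is the
  one at which crossing \<open>c\<close> stays competitive even if \<open>c\<close> turns out to be the edge to avoid.

  For the lower bound, a closed tour crosses every cut an even number of times. Hence it uses each stem
  edge twice and any two cycle edges at least twice in total, so it costs at least \<open>2 * P + C\<close> or
  \<open>2 * P + 2 * (C - m)\<close> for the weight \<open>m\<close> of some cycle edge.\<close>

section \<open>Edges and cost of vertex lists\<close>

lemma path_edges_Nil [simp]: "path_edges [] = {}"
  and path_edges_single [simp]: "path_edges [v] = {}"
  by (auto simp: path_edges_def)

lemma path_edges_Cons [simp]: "path_edges (u # v # w) = insert {u, v} (path_edges (v # w))"
proof -
  have "{i. Suc i < length (u # v # w)} = insert 0 (Suc ` {i. Suc i < length (v # w)})"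
    by (auto simp: image_iff less_Suc_eq_0_disj)
  then show ?thesis
    unfolding path_edges_def setcompr_eq_image by (simp add: image_image)
qed

lemma path_edges_append:
  "xs \<noteq> [] \<Longrightarrow> ys \<noteq> [] \<Longrightarrow>
    path_edges (xs @ ys) = insert {last xs, hd ys} (path_edges xs \<union> path_edges ys)"
proof (induction xs rule: induct_list012)
  case (2 x)
  then show ?case by (cases ys) auto
qed auto

lemma path_edges_rev [simp]: "path_edges (rev xs) = path_edges xs"
proof (induction xs)
  case (Cons x xs)
  show ?case
  proof (cases "xs = []")
    case False
    then have "path_edges (rev (x # xs)) = insert {hd xs, x} (path_edges xs)"
      using Cons path_edges_append[of "rev xs" "[x]"] by (simp add: last_rev)
    then show ?thesis using False by (cases xs) (auto simp: insert_commute)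
  qed simp
qed simp

lemma path_edges_subset: "e \<in> path_edges xs \<Longrightarrow> e \<subseteq> set xs"
  by (auto simp: path_edges_def)

lemma path_edges_infix: "path_edges ys \<subseteq> path_edges (xs @ ys @ zs)"
proof -
  have "path_edges ys \<subseteq> path_edges (ys @ zs)"
    by (cases "ys = [] \<or> zs = []") (auto simp: path_edges_append)
  also have "\<dots> \<subseteq> path_edges (xs @ ys @ zs)"
    by (cases "xs = [] \<or> ys @ zs = []") (auto simp: path_edges_append)
  finally show ?thesis .
qed

lemma finite_path_edges [simp]: "finite (path_edges xs)"
  by (induction xs rule: induct_list012) auto

lemma path_edges_split:
  assumes "e \<in> path_edges xs"
  obtains ys p v zs where "xs = ys @ p # v # zs" "e = {p, v}"
proof -
  from assms obtain i where i: "Suc i < length xs" "e = {xs ! i, xs ! Suc i}"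
    by (auto simp: path_edges_def)
  then have "xs = take i xs @ xs ! i # xs ! Suc i # drop (Suc (Suc i)) xs"
    by (metis Cons_nth_drop_Suc Suc_lessD append_take_drop_id)
  with i that show thesis by blast
qed

lemma finite_cycle_edges [simp]: "finite (cycle_edges xs)"
  by (simp add: cycle_edges_def)

lemma cycle_edges_rotate: "cycle_edges (xs @ ys) = cycle_edges (ys @ xs)"
  by (cases "xs = [] \<or> ys = []") (auto simp: cycle_edges_def path_edges_append)

lemma cycle_edges_rev: "xs \<noteq> [] \<Longrightarrow> cycle_edges (rev xs) = cycle_edges xs"
  by (simp add: cycle_edges_def hd_rev last_rev insert_commute)

lemma walk_cost_Nil [simp]: "walk_cost G [] = 0"
  and walk_cost_single [simp]: "walk_cost G [v] = 0"
  by (auto simp: walk_cost_def)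

lemma walk_cost_Cons [simp]:
  "walk_cost G (u # v # w) = weight G {u, v} + walk_cost G (v # w)"
  by (simp add: walk_cost_def sum.lessThan_Suc_shift del: sum.lessThan_Suc)

lemma walk_cost_append:
  "xs \<noteq> [] \<Longrightarrow> ys \<noteq> [] \<Longrightarrow>
    walk_cost G (xs @ ys) = walk_cost G xs + weight G {last xs, hd ys} + walk_cost G ys"
proof (induction xs rule: induct_list012)
  case (2 x)
  then show ?case by (cases ys) auto
qed auto

lemma walk_cost_join:
  assumes "xs \<noteq> []"
  shows "walk_cost G (xs @ ys) = walk_cost G xs + walk_cost G (last xs # ys)"
  using assms by (cases ys) (auto simp: walk_cost_append)

lemma walk_cost_Cons_join:
  assumes "xs \<noteq> []"
  shows "walk_cost G (v # xs @ ys) = walk_cost G (v # xs) + walk_cost G (last xs # ys)"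
  using walk_cost_join[of "v # xs" G ys] assms by simp

lemma walk_cost_rev [simp]: "walk_cost G (rev xs) = walk_cost G xs"
proof (induction xs)
  case (Cons x xs)
  show ?case
  proof (cases "xs = []")
    case False
    then have "walk_cost G (rev (x # xs)) = weight G {hd xs, x} + walk_cost G xs"
      using Cons walk_cost_append[of "rev xs" "[x]" G] by (simp add: last_rev)
    then show ?thesis using False by (cases xs) (auto simp: insert_commute)
  qed simp
qed simp

lemma walk_cost_there_and_back:
  assumes "xs \<noteq> []"
  shows "walk_cost G (x # xs @ rev (butlast xs) @ x # ws) = 2 * walk_cost G (x # xs) + walk_cost G (x # ws)"
proof -
  have "last xs # rev (butlast xs) @ [x] = rev (x # xs)"
    using assms by (cases xs rule: rev_cases) auto
  then have "walk_cost G (last xs # rev (butlast xs) @ [x]) = walk_cost G (x # xs)"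
    by (metis walk_cost_rev)
  then show ?thesis
    using walk_cost_Cons_join[OF assms, of G x "rev (butlast xs) @ x # ws"]
      walk_cost_Cons_join[of "rev (butlast xs) @ [x]" G "last xs" ws]
    by simp
qed

lemma walk_cost_distinct: "distinct xs \<Longrightarrow> walk_cost G xs = sum (weight G) (path_edges xs)"
proof (induction xs rule: induct_list012)
  case (3 x y zs)
  then have "{x, y} \<notin> path_edges (y # zs)" using path_edges_subset by fastforce
  with 3 show ?case by simp
qed auto

lemma walk_cost_nonneg:
  assumes "\<And>e. e \<in> path_edges xs \<Longrightarrow> 0 \<le> weight G e"
  shows "0 \<le> walk_cost G xs"
  using assms by (induction xs rule: induct_list012) auto

lemma cycle_edges_sum:
  assumes "distinct xs" "3 \<le> length xs"
  shows "sum (weight G) (cycle_edges xs) = walk_cost G xs + weight G {last xs, hd xs}"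
proof -
  obtain x y zs where xs: "xs = x # y # zs" "zs \<noteq> []"
    using assms(2) by (cases xs rule: remdups_adj.cases) force+
  have "{last xs, hd xs} \<notin> path_edges xs"
  proof
    assume "{last xs, hd xs} \<in> path_edges xs"
    then consider "{last zs, x} = {x, y}" | "{last zs, x} \<in> path_edges (y # zs)"
      using xs by auto
    then show False
    proof cases
      case 1
      then show False using assms(1) xs by (auto simp: doubleton_eq_iff)
    next
      case 2
      then show False using assms(1) xs path_edges_subset by fastforce
    qed
  qed
  then show ?thesis using assms(1) by (simp add: cycle_edges_def walk_cost_distinct)
qed

text \<open>Two lists that lead to a common last vertex, here always the base vertex, become one arc
  from \<open>hd xs\<close> to \<open>hd ys\<close>; the tail avoids listing the common vertex
  twice.\<close>

definition glue :: "'v list \<Rightarrow> 'v list \<Rightarrow> 'v list" where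
  "glue xs ys = xs @ tl (rev ys)"

lemma glue_Cons: "v # glue rs ls = glue (v # rs) ls"
  by (simp add: glue_def)

lemma
  assumes "xs \<noteq> []" "ys \<noteq> []" "last xs = last ys"
  shows rev_glue: "rev (glue xs ys) = glue ys xs"
    and last_glue: "last (glue xs ys) = hd ys"
    and walk_cost_glue: "walk_cost G (glue xs ys) = walk_cost G xs + walk_cost G ys"
    and path_edges_glue: "path_edges (glue xs ys) = path_edges xs \<union> path_edges ys"
    and set_glue: "set (glue xs ys) = set xs \<union> set ys"
proof -
  obtain xs' z where xs: "xs = xs' @ [z]" using assms(1) by (cases xs rule: rev_cases) auto
  obtain ys' where ys: "ys = ys' @ [z]" using assms xs by (cases ys rule: rev_cases) auto
  have g: "glue xs ys = xs @ rev ys'" "glue ys xs = ys @ rev xs'"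
    by (auto simp: glue_def xs ys)
  show "rev (glue xs ys) = glue ys xs" by (simp add: g) (simp add: xs ys)
  show "last (glue xs ys) = hd ys" unfolding g by (cases ys') (auto simp: xs ys)
  have eq: "z # rev ys' = rev ys" by (simp add: ys)
  show "walk_cost G (glue xs ys) = walk_cost G xs + walk_cost G ys"
    using walk_cost_join[OF assms(1), of G "rev ys'"] by (simp only: g) (simp add: xs eq)
  show "path_edges (glue xs ys) = path_edges xs \<union> path_edges ys"
  proof (cases "ys' = []")
    case False
    then show ?thesis
      using path_edges_append[OF assms(1), of "rev ys'"] path_edges_append[of ys' "[z]"]
      by (simp only: g) (auto simp: ys hd_rev xs insert_commute)
  qed (simp add: glue_def ys)
  show "set (glue xs ys) = set xs \<union> set ys" unfolding g by (auto simp: xs ys)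
qed

section \<open>Closed walks and cuts\<close>

text \<open>A list rather than the set \<open>path_edges\<close>, since the lower bound needs the
  multiplicity of each edge.\<close>

definition steps :: "'v list \<Rightarrow> 'v set list" where
  "steps w = map (\<lambda>(u, v). {u, v}) (zip w (tl w))"

lemma steps_simps [simp]:
  "steps [] = []" "steps [v] = []" "steps (u # v # w) = {u, v} # steps (v # w)"
  by (auto simp: steps_def)

lemma set_steps: "set (steps w) = path_edges w"
  by (induction w rule: induct_list012) auto

lemma walk_cost_steps: "walk_cost G w = sum_list (map (weight G) (steps w))"
  by (induction w rule: induct_list012) auto

definition crosses :: "'v set \<Rightarrow> 'v set \<Rightarrow> bool" where
  "crosses S e \<longleftrightarrow> e \<inter> S \<noteq> {} \<and> \<not> e \<subseteq> S"

lemma even_crossings: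
  "w \<noteq> [] \<Longrightarrow> even (length (filter (crosses S) (steps w))) \<longleftrightarrow> (hd w \<in> S \<longleftrightarrow> last w \<in> S)"
  by (induction w rule: induct_list012) (auto simp: crosses_def)

lemma no_crossing:
  "filter (crosses S) (steps w) = [] \<Longrightarrow> x \<in> set w \<Longrightarrow> x \<in> S \<longleftrightarrow> hd w \<in> S"
  by (induction w rule: induct_list012) (auto simp: crosses_def split: if_splits)

text \<open>Each crossing switches sides, so a closed walk makes an even number of them; it makes
  some because it visits both sides.\<close>

lemma closed_walk_crossings:
  assumes "hd w = last w" "x \<in> set w" "x \<in> S" "y \<in> set w" "y \<notin> S"
  shows "2 \<le> length (filter (crosses S) (steps w))"
proof -
  have "length (filter (crosses S) (steps w)) \<noteq> 0"
    unfolding length_0_conv using no_crossing[of S w x] no_crossing[of S w y] assms by blast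
  moreover have "even (length (filter (crosses S) (steps w)))"
    using even_crossings[of w S] assms by fastforce
  ultimately show ?thesis by (metis dvd_imp_le neq0_conv)
qed

lemma sum_list_count:
  fixes f :: "'a \<Rightarrow> real"
  assumes "finite A" "set xs \<subseteq> A"
  shows "sum_list (map f xs) = (\<Sum>e \<in> A. real (count_list xs e) * f e)"
  using assms(2)
proof (induction xs)
  case (Cons x xs)
  have "(\<Sum>e \<in> A. real (count_list (x # xs) e) * f e)
      = (\<Sum>e \<in> A. (if x = e then f e else 0) + real (count_list xs e) * f e)"
    by (intro sum.cong) (auto simp: algebra_simps)
  then show ?case using Cons assms(1) by (simp add: sum.distrib)
qed simp

text \<open>Meant for a cut that consists of two edges: its crossings are shared between their
  multiplicities.\<close>

lemma filter_length_le_count: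
  assumes "\<And>e. e \<in> set xs \<Longrightarrow> P e \<Longrightarrow> e = a \<or> e = b" "a \<noteq> b"
  shows "length (filter P xs) \<le> count_list xs a + count_list xs b"
  using assms(1)
proof (induction xs)
  case (Cons x xs)
  then have "length (filter P xs) \<le> count_list xs a + count_list xs b" by auto
  moreover have "\<not> P x \<or> x = a \<or> x = b" using Cons.prems[of x] by auto
  ultimately show ?case using assms(2) by auto
qed simp

lemma filter_length_le_count1:
  assumes "\<And>e. e \<in> set xs \<Longrightarrow> P e \<Longrightarrow> e = a"
  shows "length (filter P xs) \<le> count_list xs a"
  using assms
proof (induction xs)
  case (Cons x xs)
  then have "length (filter P xs) \<le> count_list xs a" by auto
  moreover have "\<not> P x \<or> x = a" using Cons.prems[of x] by auto
  ultimately show ?case by (cases "P x") simp_all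
qed simp


section \<open>The explorer\<close>

text \<open>The searcher plans a sequence of moves through known vertices up to the next unknown one,
  and consults its mode again only when this plan is used up.
  \<open>Down st k\<close>: walk down the stem to the leaf, return along the stack \<open>st\<close> and continue as \<open>k\<close>.
  \<open>Up h q\<close>: walk up the stem towards the junction, coming from \<open>h\<close>; \<open>q\<close> leads back to the start.
  \<open>Cyc rs ls y a r l E H k\<close>: explore the cycle. The searcher stands at one end of the explored arc;
  \<open>rs\<close> leads from there back to the base vertex and has length \<open>r\<close>, while \<open>ls\<close> of length \<open>l\<close>
  leads from the other end to the base vertex. Beyond the other end lies \<open>y\<close>, at distance \<open>a\<close>. The
  cost spent on the cycle so far is \<open>E + r\<close>, and \<open>H\<close> holds the first stem vertex once it has been
  identified.\<close>
datatype 'v mode =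
    Start
  | Down "'v list" "'v mode"
  | Up 'v "'v list"
  | Cyc "'v list" "'v list" 'v real real real real "'v set" "'v mode"
  | Ret "'v list"

text \<open>An arbitrary ordering that depends on the set alone, so that advice can name a neighbour
  by its position.\<close>

definition enum :: "'v set \<Rightarrow> 'v list" where
  "enum S = (SOME xs. distinct xs \<and> set xs = S)"

definition bits :: "bool list \<Rightarrow> nat" where
  "bits b = 2 * of_bool (b ! 0) + of_bool (b ! 1)"

text \<open>The lighter of the two cycle edges is crossed first. The start \<open>v\<close> is the
  base vertex and at first also the far end of the arc, hence both return lists are
  \<open>[v]\<close>.\<close>

definition cyc_start :: "'v observation \<Rightarrow> 'v set \<Rightarrow> 'v mode \<Rightarrow> 'v mode \<times> 'v list" where
  "cyc_start ob H k = (let (v, m) = ob;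
     (x, y) = (SOME (x, y). dom m - H = {x, y} \<and> x \<noteq> y \<and> the (m x) \<le> the (m y))
     in (Cyc [v] [v] y (the (m y)) (the (m x)) 0 0 H k, [x]))"

text \<open>In \<open>Cyc\<close>, degree 3 with \<open>H = {}\<close> reveals the junction. If
  \<open>n = hd ls\<close>, only the closing edge is unexplored and the shorter way back to the base
  is taken. Turning round swaps the two ends: the spending \<open>E + r\<close> grows by
  \<open>r + l + a\<close>, which splits into the new distance \<open>l + a\<close> and the new
  excess \<open>E + 2 * r\<close>.\<close>

fun decide :: "bool list \<Rightarrow> 'v mode \<Rightarrow> 'v observation \<Rightarrow> 'v mode \<times> 'v list" where
  "decide b Start (s, m) =
    (if card (dom m) = 1 then (Up s [s], [the_elem (dom m)])
     else if card (dom m) = 2 \<and> \<not> b ! 0 then cyc_start (s, m) {} (Ret [])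
     else let n = enum (dom m) ! (bits b mod card (dom m)) in (Down [s] (Up n []), [n]))"
| "decide b (Down st k) (v, m) =
    (if card (dom m) = 1 then (k, st) else (Down (v # st) k, [the_elem (dom m - {hd st})]))"
| "decide b (Up h q) (v, m) =
    (if card (dom m) = 3 then cyc_start (v, m) {h} (Ret q)
     else (Up v (v # q), [the_elem (dom m - {h})]))"
| "decide b (Cyc rs ls y a r l E H k) (v, m) =
    (if H = {} \<and> card (dom m) = 3
     then let h = enum (dom m - {hd rs}) ! (bits b mod 2)
       in (Down [v] (Cyc rs ls y a r l E {h} k), [h])
     else let n = the_elem (dom m - H - {hd rs}); c = the (m n) in
       if n = hd ls then (k, if c + l \<le> r then ls else rs)
       else if E + c \<le> sqrt 3 * (r + l + a) then (Cyc (v # rs) ls y a (r + c) l E H k, [n])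
       else (Cyc ls (v # rs) n c (l + a) r (E + 2 * r) H k, glue rs ls @ [y]))"
| "decide b (Ret q) ob = (Ret [], q)"

text \<open>The head of the plan is the vertex just reached. Since \<open>tl [] = []\<close>, the
  empty initial plan leads to a decision at the start vertex.\<close>

fun update :: "bool list \<Rightarrow> 'v mode \<times> 'v list \<Rightarrow> 'v observation \<Rightarrow> 'v mode \<times> 'v list" where
  "update b (k, us) ob = (if tl us = [] then decide b k ob else (k, tl us))"

definition explorer :: "'v explorer" where
  "explorer b obs = (case snd (foldl (update b) (Start, []) obs) of [] \<Rightarrow> None | u # _ \<Rightarrow> Some u)"

text \<open>Executions cut into whole plans: \<open>ws\<close> lists the moves made until halting by
  a searcher who is about to decide at \<open>v\<close> in mode \<open>k\<close>.\<close>

inductive run :: "bool list \<Rightarrow> 'v wgraph \<Rightarrow> 'v mode \<Rightarrow> 'v \<Rightarrow> 'v list \<Rightarrow> bool"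
  for b :: "bool list" and G :: "'v wgraph" where
  halt: "decide b k (observe G v) = (k', []) \<Longrightarrow> run b G k v []"
| go: "\<lbrakk>decide b k (observe G v) = (k', us); us \<noteq> []; path_edges (v # us) \<subseteq> edges G;
    run b G k' (last us) ws\<rbrakk> \<Longrightarrow> run b G k v (us @ ws)"

lemma run_step:
  assumes "decide b k (observe G v) = (k', [u])" "{v, u} \<in> edges G" "run b G k' u ws"
  shows "run b G k v (u # ws)"
  using run.go[OF assms(1), of ws] assms(2,3) by simp

text \<open>Carries out one plan. The observation at its last vertex is left out of the folded
  history by \<open>butlast\<close>, since the next decision is made on it.\<close>

lemma execution_follow:
  assumes "execution explorer b G s (w @ [v])"
    "foldl (update b) (Start, []) (map (observe G) (w @ [v])) = (k, us)"
    "us \<noteq> []" "path_edges (v # us) \<subseteq> edges G"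
  shows "execution explorer b G s (w @ v # us) \<and>
    (\<exists>p. foldl (update b) (Start, []) (map (observe G) (w @ butlast (v # us))) = (k, p) \<and> tl p = [])"
  using assms
proof (induction us arbitrary: w v)
  case (Cons u us)
  have "explorer b (map (observe G) (w @ [v])) = Some u"
    using Cons.prems(2) unfolding explorer_def by simp
  moreover have "{v, u} \<in> edges G" using Cons.prems(4) by (cases us) auto
  ultimately have ex: "execution explorer b G s ((w @ [v]) @ [u])"
    using execution.move[OF Cons.prems(1)] by simp
  show ?case
  proof (cases us)
    case Nil
    then show ?thesis using ex Cons.prems(2) by simp
  next
    case (Cons u' us')
    have "foldl (update b) (Start, []) (map (observe G) ((w @ [v]) @ [u])) = (k, us)"
      using Cons.prems(2) Cons by simp
    from Cons.IH[OF ex this] show ?thesis using Cons Cons.prems(4) by auto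
  qed
qed simp

text \<open>The condition \<open>tl p = []\<close> expresses that the plan is used up on arrival at
  \<open>v\<close>, so that the mode \<open>k\<close> is consulted there.\<close>

lemma run_halts:
  assumes "run b G k v ws" "execution explorer b G s (w @ [v])"
    "foldl (update b) (Start, []) (map (observe G) w) = (k, p)" "tl p = []"
  shows "halts_with explorer b G s (w @ v # ws)"
  using assms
proof (induction arbitrary: w p rule: run.induct)
  case (halt k v k')
  then show ?case by (simp add: halts_with_def explorer_def)
next
  case (go k v k' us ws)
  have "foldl (update b) (Start, []) (map (observe G) (w @ [v])) = (k', us)"
    using go by simp
  from execution_follow[OF go.prems(1) this go.hyps(2,3)]
  obtain p' where ex: "execution explorer b G s (w @ v # us)"
    and p': "foldl (update b) (Start, []) (map (observe G) (w @ butlast (v # us))) = (k', p')"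
      "tl p' = []" by blast
  have us: "v # us = butlast (v # us) @ [last us]"
    using append_butlast_last_id[of "v # us"] go.hyps(2) by simp
  have "execution explorer b G s ((w @ butlast (v # us)) @ [last us])"
    using ex us by (metis append.assoc)
  from go.IH[OF this p'] have "halts_with explorer b G s (w @ (butlast (v # us) @ [last us]) @ ws)"
    by (simp only: append.assoc append_Cons append_Nil)
  then show ?case by (simp only: us[symmetric] append_Cons)
qed

lemma run_path_edges: "run b G k v ws \<Longrightarrow> path_edges (v # ws) \<subseteq> edges G"
proof (induction rule: run.induct)
  case (go k v k' us ws)
  then show ?case using path_edges_append[of "v # us" ws] by (cases ws) auto
qed simp

lemma run_explores:
  assumes "run b G Start s ws" "last (s # ws) = s" "set (s # ws) = verts G"
    "walk_cost G (s # ws) \<le> K"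
  shows "explores_with_cost_le explorer b G s K"
proof -
  have "halts_with explorer b G s ([] @ s # ws)"
    using assms(1) by (rule run_halts[where p = "[]"]) (auto intro: execution.start)
  then show ?thesis
    unfolding explores_with_cost_le_def exploration_tour_def walk_def
    using run_path_edges[OF assms(1)] assms by (intro exI[of _ "s # ws"]) simp
qed

lemma enum_nth:
  assumes "finite S" "x \<in> S"
  obtains i where "i < card S" "enum S ! i = x"
proof -
  have "distinct (enum S) \<and> set (enum S) = S"
    unfolding enum_def by (rule someI_ex) (use finite_distinct_list[OF assms(1)] in blast)
  then show thesis using that assms(2) by (metis distinct_card in_set_conv_nth)
qed

section \<open>Real inequalities\<close>

lemma sqrt3: "sqrt 3 * sqrt 3 = 3" "1 < sqrt 3" "sqrt 3 < 2"
  using real_sqrt_less_iff[of 3 4] by auto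

text \<open>The origin of \<open>sqrt 3\<close>. With a threshold factor \<open>t\<close> in its
  place, the bound on \<open>E\<close> carries over to the opposite side of the arc if
  \<open>3 - t \<le> (t - 1) * t\<close>, that is \<open>3 \<le> t * t\<close>; the final ratio is
  \<open>(1 + t) / 2\<close>, so the smallest such \<open>t\<close> is taken.\<close>

lemma turn_bounds:
  assumes "sqrt 3 * (r + l + a) < E + c" "E \<le> (sqrt 3 - 1) * (l + a)" "0 \<le> r" "0 \<le> l" "0 \<le> a"
  shows "3 * r + sqrt 3 * (l + a) \<le> sqrt 3 * c"
    "E + 2 * r \<le> (sqrt 3 - 1) * (r + c)"
proof -
  have c: "sqrt 3 * r + l + a \<le> c" using assms by (simp add: algebra_simps)
  have "sqrt 3 * (sqrt 3 * r + l + a) \<le> sqrt 3 * c"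
    using c by (intro mult_left_mono) auto
  moreover have "sqrt 3 * (sqrt 3 * r) = 3 * r" using sqrt3(1) by (metis mult.assoc)
  ultimately show "3 * r + sqrt 3 * (l + a) \<le> sqrt 3 * c" by (simp add: distrib_left)
  have "(sqrt 3 - 1) * (sqrt 3 * (r + l + a)) \<le> (sqrt 3 - 1) * (E + c)"
    using assms(1) by (intro mult_left_mono) (auto simp: less_imp_le)
  moreover have "sqrt 3 * E \<le> sqrt 3 * ((sqrt 3 - 1) * (l + a))"
    using assms(2) by (intro mult_left_mono) auto
  moreover have "(sqrt 3 - 1) * (sqrt 3 * t) = 3 * t - sqrt 3 * t"
    "sqrt 3 * ((sqrt 3 - 1) * t) = 3 * t - sqrt 3 * t" for t
    using sqrt3(1) by (auto simp: algebra_simps simp flip: mult.assoc)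
  ultimately show "E + 2 * r \<le> (sqrt 3 - 1) * (r + c)" by (simp add: algebra_simps)
qed

text \<open>Here \<open>z\<close> is the way back to the base across the closing edge and
  \<open>r\<close> the way back along the arc. The two cases meet at \<open>z = r\<close>, where the
  estimate is tight.\<close>

lemma final_bound:
  fixes r z E :: real
  assumes "E \<le> (sqrt 3 - 1) * z"
  shows "E + r + min z r \<le> (1 + sqrt 3) / 2 * (r + z)"
proof (cases "z \<le> r")
  case True
  then have "(sqrt 3 - 1) * z \<le> (sqrt 3 - 1) * ((r + z) / 2)"
    using sqrt3 by (intro mult_left_mono) auto
  then show ?thesis using True assms by (simp add: field_simps min_def)
next
  case False
  then have "(3 - sqrt 3) * r \<le> (3 - sqrt 3) * z"
    using sqrt3 by (intro mult_left_mono) auto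
  then show ?thesis using False assms by (simp add: field_simps min_def)
qed

section \<open>Tadpole graphs\<close>

locale tadpole_graph =
  fixes G :: "'v wgraph" and cs ps :: "'v list" and j :: 'v
  assumes len: "3 \<le> length cs" and ps_ne: "ps \<noteq> []" and dist: "distinct (cs @ ps)"
    and j: "j \<in> set cs" and verts: "verts G = set cs \<union> set ps"
    and edges: "edges G = cycle_edges cs \<union> path_edges (j # ps)"
    and pos: "\<And>e. e \<in> edges G \<Longrightarrow> 0 < weight G e"
begin

section \<open>Listings of the cycle from any vertex and in either direction\<close>

definition ring :: "'v list \<Rightarrow> bool" where
  "ring zs \<longleftrightarrow> distinct zs \<and> set zs = set cs \<and> cycle_edges zs = cycle_edges cs"

lemma ring_cs: "ring cs"
  using dist by (simp add: ring_def)

lemma ring_length: "ring zs \<Longrightarrow> 3 \<le> length zs"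
  using len dist by (metis distinct_append distinct_card ring_def)

lemma ring_rotate: "ring (xs @ ys) \<Longrightarrow> ring (ys @ xs)"
  by (auto simp: ring_def cycle_edges_rotate[of xs ys])

lemma ring_rev: "ring xs \<Longrightarrow> ring (rev xs)"
  using ring_length[of xs] cycle_edges_rev[of xs] by (force simp: ring_def)

text \<open>Rotating the listing to start just behind the edge turns the rest of the cycle into a
  path.\<close>

lemma ring_closing_edge:
  assumes "e \<in> cycle_edges cs"
  obtains zs where "ring zs" "e = {last zs, hd zs}"
proof (cases "e \<in> path_edges cs")
  case True
  then obtain xs p v ys where "cs = xs @ p # v # ys" "e = {p, v}"
    by (rule path_edges_split)
  then show thesis
    using that[of "(v # ys) @ (xs @ [p])"] ring_rotate[of "xs @ [p]" "v # ys"] ring_cs by simp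
next
  case False
  then show thesis using that[of cs] ring_cs assms by (auto simp: cycle_edges_def)
qed

lemma cycle_edges_subset: "e \<in> cycle_edges cs \<Longrightarrow> e \<subseteq> set cs"
  using path_edges_subset[of e cs] len by (cases "cs = []") (auto simp: cycle_edges_def)

lemma stem_edge_not_cycle: "e \<in> path_edges (j # ps) \<Longrightarrow> e \<notin> cycle_edges cs"
proof
  assume "e \<in> path_edges (j # ps)" "e \<in> cycle_edges cs"
  moreover from this(1) obtain xs p v ys where "j # ps = xs @ p # v # ys" "e = {p, v}"
    by (rule path_edges_split)
  moreover from this have "v \<in> set ps" by (cases xs) auto
  ultimately show False using cycle_edges_subset[of e] dist by auto
qed

section \<open>Costs of cycle and stem, and the lower bound for closed tours\<close>

definition cycle_cost :: real where "cycle_cost = sum (weight G) (cycle_edges cs)"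
definition stem_cost :: real where "stem_cost = walk_cost G (j # ps)"

lemma distinct_stem: "distinct (j # ps)"
  using dist j by auto

lemma stem_cost_sum: "stem_cost = sum (weight G) (path_edges (j # ps))"
  using walk_cost_distinct[OF distinct_stem] by (simp add: stem_cost_def)

lemma ring_cost: "ring zs \<Longrightarrow> cycle_cost = walk_cost G zs + weight G {last zs, hd zs}"
  using cycle_edges_sum[of zs G] ring_length[of zs] by (simp add: ring_def cycle_cost_def)

text \<open>The edge is a bridge: it alone leaves the set of stem vertices beyond it.\<close>

lemma stem_edge_count:
  assumes "exploration_tour G s w" "e \<in> path_edges (j # ps)"
  shows "2 \<le> count_list (steps w) e"
proof -
  obtain xs p v ys where "j # ps = xs @ p # v # ys" "e = {p, v}"
    using assms(2) by (rule path_edges_split)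
  then have split: "j # ps = (xs @ [p]) @ v # ys" "e = {p, v}" by simp_all
  have stem: "path_edges (j # ps) = insert e (path_edges (xs @ [p]) \<union> path_edges (v # ys))"
    unfolding split(1) by (subst path_edges_append) (auto simp: split(2))
  let ?S = "set (v # ys)"
  have sub: "?S \<subseteq> set ps" using split(1) by (cases xs) auto
  have disj: "set (xs @ [p]) \<inter> ?S = {}" using distinct_stem unfolding split(1) by auto
  have "e' = e" if e': "e' \<in> edges G" "crosses ?S e'" for e'
  proof -
    consider "e' \<subseteq> set cs" | "e' = e" | "e' \<subseteq> set (xs @ [p])" | "e' \<subseteq> ?S"
      using e'(1) cycle_edges_subset path_edges_subset unfolding edges stem by blast
    then show ?thesis using e'(2) sub disj dist unfolding crosses_def by cases auto
  qed
  then have "length (filter (crosses ?S) (steps w)) \<le> count_list (steps w) e"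
    using assms(1) by (intro filter_length_le_count1)
      (auto simp: exploration_tour_def walk_def set_steps)
  moreover have "2 \<le> length (filter (crosses ?S) (steps w))"
    using assms(1) sub j dist
    by (intro closed_walk_crossings[of w v _ j]) (auto simp: exploration_tour_def verts)
  ultimately show ?thesis by simp
qed

text \<open>Removing both edges splits the cycle into two arcs, and no other edge joins the two
  sides once the stem is counted with the arc that contains \<open>j\<close>.\<close>

lemma cycle_edge_count:
  assumes "exploration_tour G s w" "e \<in> cycle_edges cs" "e' \<in> cycle_edges cs" "e \<noteq> e'"
  shows "2 \<le> count_list (steps w) e + count_list (steps w) e'"
proof -
  obtain zs where zs: "ring zs" "e = {last zs, hd zs}"
    using ring_closing_edge[OF assms(2)] .
  have "e' \<in> path_edges zs"
    using assms(3,4) zs cycle_edges_def[of zs] unfolding ring_def by (metis insertE)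
  then obtain xs p v ys where "zs = xs @ p # v # ys" "e' = {p, v}"
    by (rule path_edges_split)
  then have split: "zs = (xs @ [p]) @ v # ys" "e' = {p, v}" by simp_all
  have cyc: "cycle_edges cs = {e, e'} \<union> path_edges (xs @ [p]) \<union> path_edges (v # ys)"
  proof -
    have "cycle_edges cs = insert e (path_edges zs)"
      using zs cycle_edges_def[of zs] by (simp only: ring_def)
    also have "path_edges zs = insert e' (path_edges (xs @ [p]) \<union> path_edges (v # ys))"
      unfolding split(1) by (subst path_edges_append) (auto simp: split(2))
    finally show ?thesis by blast
  qed
  define S where "S = set (xs @ [p]) \<union> (if j \<in> set (xs @ [p]) then set ps else {})"
  have cs: "set (xs @ [p]) \<union> set (v # ys) = set cs" "set (xs @ [p]) \<inter> set (v # ys) = {}"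
    using zs(1) unfolding ring_def split(1) by auto
  have "e'' = e \<or> e'' = e'" if e'': "e'' \<in> edges G" "crosses S e''" for e''
  proof -
    consider "e'' = e" | "e'' = e'" | "e'' \<subseteq> set (xs @ [p])" | "e'' \<subseteq> set (v # ys)"
      | "e'' \<subseteq> insert j (set ps)"
      using e''(1) path_edges_subset[of e'' "xs @ [p]"] path_edges_subset[of e'' "v # ys"]
        path_edges_subset[of e'' "j # ps"] list.simps(15)[of j ps]
      unfolding edges cyc by blast
    then show ?thesis
    proof cases
      case 3
      then have "e'' \<subseteq> S" unfolding S_def by blast
      then show ?thesis using e''(2) by (simp add: crosses_def)
    next
      case 4
      then have "e'' \<inter> S = {}" using cs dist unfolding S_def by auto
      then show ?thesis using e''(2) by (simp add: crosses_def)
    next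
      case 5
      moreover have "insert j (set ps) \<inter> S = {} \<or> insert j (set ps) \<subseteq> S"
        using cs dist j unfolding S_def by (cases "j \<in> set (xs @ [p])") auto
      ultimately have "e'' \<inter> S = {} \<or> e'' \<subseteq> S" by blast
      then show ?thesis using e''(2) by (simp add: crosses_def)
    qed blast+
  qed
  then have "length (filter (crosses S) (steps w)) \<le> count_list (steps w) e + count_list (steps w) e'"
    using assms(1) by (intro filter_length_le_count[OF _ assms(4)])
      (auto simp: exploration_tour_def walk_def set_steps)
  moreover have "2 \<le> length (filter (crosses S) (steps w))"
  proof (rule closed_walk_crossings[of w p _ v])
    show "p \<in> S" "v \<notin> S" using cs dist unfolding S_def by auto
    have "p \<in> set cs" "v \<in> set cs" using cs by auto
    then show "p \<in> set w" "v \<in> set w" using assms(1) by (auto simp: exploration_tour_def verts)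
  qed (use assms(1) in \<open>auto simp: exploration_tour_def\<close>)
  ultimately show ?thesis by simp
qed

text \<open>The two ways to tour the cycle alone: once around, or back and forth avoiding one edge.\<close>
definition cycle_bound :: "real \<Rightarrow> bool" where
  "cycle_bound X \<longleftrightarrow> cycle_cost \<le> X \<or> (\<exists>m \<in> cycle_edges cs. 2 * (cycle_cost - weight G m) \<le> X)"

lemma tour_lower_bound:
  assumes "exploration_tour G s w"
  obtains X where "cycle_bound X" "2 * stem_cost + X \<le> walk_cost G w"
proof -
  let ?c = "\<lambda>e. real (count_list (steps w) e)"
  let ?X = "\<Sum>e \<in> cycle_edges cs. ?c e * weight G e"
  have pos': "0 \<le> weight G e" if "e \<in> cycle_edges cs \<union> path_edges (j # ps)" for e
    using pos[of e] that by (simp add: edges)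
  have "walk_cost G w = (\<Sum>e \<in> edges G. ?c e * weight G e)"
    unfolding walk_cost_steps
    using assms by (intro sum_list_count)
      (auto simp: set_steps exploration_tour_def walk_def edges)
  also have "\<dots> = ?X + (\<Sum>e \<in> path_edges (j # ps). ?c e * weight G e)"
    unfolding edges using stem_edge_not_cycle by (intro sum.union_disjoint) auto
  finally have "walk_cost G w = ?X + (\<Sum>e \<in> path_edges (j # ps). ?c e * weight G e)" .
  moreover have "(\<Sum>e \<in> path_edges (j # ps). ?c e * weight G e)
      \<ge> (\<Sum>e \<in> path_edges (j # ps). 2 * weight G e)"
    using stem_edge_count[OF assms] pos' by (intro sum_mono mult_right_mono) auto
  ultimately have "2 * stem_cost + ?X \<le> walk_cost G w"
    by (simp add: stem_cost_sum sum_distrib_left)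
  moreover have "cycle_bound ?X"
  proof (cases "\<exists>m \<in> cycle_edges cs. count_list (steps w) m = 0")
    case True
    then obtain m where m: "m \<in> cycle_edges cs" "count_list (steps w) m = 0" by blast
    have "2 * (cycle_cost - weight G m) = (\<Sum>e \<in> cycle_edges cs - {m}. 2 * weight G e)"
      using m(1) by (simp add: cycle_cost_def sum_diff1 flip: sum_distrib_left)
    also have "\<dots> \<le> (\<Sum>e \<in> cycle_edges cs - {m}. ?c e * weight G e)"
    proof (intro sum_mono mult_right_mono)
      fix e assume e: "e \<in> cycle_edges cs - {m}"
      then show "2 \<le> ?c e" using cycle_edge_count[OF assms m(1), of e] m(2) by auto
      show "0 \<le> weight G e" using pos' e by auto
    qed
    also have "\<dots> = ?X" using m by (simp add: sum_diff1)
    finally show ?thesis using m(1) by (auto simp: cycle_bound_def)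
  next
    case False
    then have "(\<Sum>e \<in> cycle_edges cs. 1 * weight G e) \<le> ?X"
      using pos' by (intro sum_mono mult_right_mono) (auto simp: Suc_le_eq)
    then show ?thesis by (simp add: cycle_bound_def cycle_cost_def)
  qed
  ultimately show thesis using that by blast
qed


section \<open>Neighbourhoods in a tadpole\<close>

definition nbrs :: "'v \<Rightarrow> 'v set" where
  "nbrs v = {u. {v, u} \<in> edges G}"

lemma observe_nbrs: obtains m where "observe G v = (v, m)" "dom m = nbrs v"
    "\<And>u. u \<in> nbrs v \<Longrightarrow> the (m u) = weight G {v, u}"
proof
  show "observe G v = (v, snd (observe G v))" by (simp add: observe_def)
qed (auto simp: observe_def nbrs_def split: if_splits)

lemma nbrs_stem:
  assumes "j # ps = xs @ p # v # ys"
  shows "nbrs v = insert p (set (take 1 ys))"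
proof -
  have v: "v \<in> set ps" using assms by (cases xs) auto
  then have "v \<notin> set cs" using dist by auto
  then have "nbrs v = {u. {v, u} \<in> path_edges (j # ps)}"
    using cycle_edges_subset by (auto simp: nbrs_def edges)
  also have "path_edges (j # ps) = insert {p, v} (path_edges (xs @ [p]) \<union> path_edges (v # ys))"
    using path_edges_append[of "xs @ [p]" "v # ys"] assms by simp
  also have "{u. {v, u} \<in> \<dots>} = insert p {u. {v, u} \<in> path_edges (v # ys)}"
  proof -
    have "v \<notin> set (xs @ [p])" using distinct_stem unfolding assms by auto
    then show ?thesis using path_edges_subset[of _ "xs @ [p]"] by (fastforce simp: doubleton_eq_iff)
  qed
  also have "{u. {v, u} \<in> path_edges (v # ys)} = set (take 1 ys)"
  proof (cases ys)
    case (Cons y ys')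
    have "v \<notin> set ys" using distinct_stem unfolding assms by auto
    then show ?thesis
      using path_edges_subset[of _ ys] unfolding Cons by (fastforce simp: doubleton_eq_iff)
  qed simp
  finally show ?thesis .
qed

lemma nbrs_cycle:
  assumes "v \<in> set cs"
  shows "nbrs v = {u. {v, u} \<in> cycle_edges cs} \<union> (if v = j then {hd ps} else {})"
proof -
  obtain h hs where ps: "ps = h # hs" using ps_ne by (cases ps) auto
  have v: "v \<notin> set ps" using assms dist by auto
  have "{v, u} \<in> path_edges (j # ps) \<longleftrightarrow> v = j \<and> u = hd ps" for u
    using v path_edges_subset[of "{v, u}" ps] by (auto simp: ps doubleton_eq_iff)
  then show ?thesis by (auto simp: nbrs_def edges)
qed

lemma ring_nbrs:
  assumes "ring (v # c # zs)"
  shows "{u. {v, u} \<in> cycle_edges cs} = {c, last zs}" "c \<noteq> last zs" "zs \<noteq> []"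
proof -
  show zs: "zs \<noteq> []" using ring_length[OF assms] by auto
  have d: "distinct (v # c # zs)" using assms by (simp add: ring_def)
  then show "c \<noteq> last zs" using zs by auto
  have "cycle_edges cs = {{last zs, v}, {v, c}} \<union> path_edges (c # zs)"
    using assms zs by (auto simp: ring_def cycle_edges_def[of "v # c # zs"])
  moreover have "{v, u} \<notin> path_edges (c # zs)" for u
    using d path_edges_subset[of "{v, u}" "c # zs"] by auto
  ultimately show "{u. {v, u} \<in> cycle_edges cs} = {c, last zs}"
    by (auto simp: doubleton_eq_iff)
qed

section \<open>Runs along the stem\<close>

lemma stem_path_edges: "j # ps = xs @ ys @ zs \<Longrightarrow> path_edges ys \<subseteq> edges G"
  using path_edges_infix[of ys xs zs] by (auto simp: edges)

text \<open>The descent pushes every vertex it leaves, so at the leaf the stack itself is the plan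
  for the way back, and \<open>k\<close> takes over at its bottom \<open>last st\<close>.\<close>

lemma run_Down:
  assumes "st \<noteq> []" "j # ps = xs @ rev st @ v # ys" "run b G k (last st) ws"
  shows "run b G (Down st k) v (ys @ rev (butlast (v # ys)) @ st @ ws)"
  using assms
proof (induction ys arbitrary: v st)
  case Nil
  obtain p st' where st: "st = p # st'" using Nil.prems(1) by (cases st) auto
  obtain m where m: "observe G v = (v, m)" "dom m = nbrs v" by (rule observe_nbrs)
  have "nbrs v = {p}" using nbrs_stem[of "xs @ rev st'" p v "[]"] Nil.prems(2) st by simp
  then have "decide b (Down st k) (observe G v) = (k, st)" using m by simp
  moreover have "path_edges (v # st) \<subseteq> edges G"
    using stem_path_edges[of xs "rev (v # st)" "[]"] Nil.prems(2) by (simp only: path_edges_rev) simp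
  ultimately show ?case using run.go Nil.prems by fastforce
next
  case (Cons u ys)
  obtain p st' where st: "st = p # st'" using Cons.prems(1) by (cases st) auto
  obtain m where m: "observe G v = (v, m)" "dom m = nbrs v" by (rule observe_nbrs)
  have "nbrs v = {p, u}" using nbrs_stem[of "xs @ rev st'" p v "u # ys"] Cons.prems(2) st by simp
  moreover have "p \<noteq> u" using distinct_stem unfolding Cons.prems(2) st by auto
  ultimately have "decide b (Down st k) (observe G v) = (Down (v # st) k, [u])"
    using m st by (simp add: insert_Diff_if)
  moreover have "{v, u} \<in> edges G"
    using stem_path_edges[of "xs @ rev st" "[v, u]" ys] Cons.prems(2) by simp
  moreover have "run b G (Down (v # st) k) u (ys @ rev (butlast (u # ys)) @ (v # st) @ ws)"
    using Cons.IH[of "v # st" u] Cons.prems by simp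
  ultimately have "run b G (Down st k) v (u # ys @ rev (butlast (u # ys)) @ (v # st) @ ws)"
    by (rule run_step)
  then show ?case by simp
qed

text \<open>The condition on \<open>h\<close> covers two cases: \<open>h\<close> is the next vertex
  outwards, or \<open>v\<close> is the leaf and \<open>h = v\<close>. In both, discarding
  \<open>h\<close> leaves only the neighbour towards the junction.\<close>

lemma run_Up:
  assumes "j # ps = xs @ v # ys" "set (take 1 ys) - {v} = {h} - {v}"
    "run b G (Up (hd ps) (tl (xs @ [v]) @ q)) j ws"
  shows "run b G (Up h q) v (rev xs @ ws)"
  using assms
proof (induction xs arbitrary: v ys h q rule: rev_induct)
  case Nil
  then have "ys = ps" "v = j" by auto
  moreover have "hd ps \<noteq> j" using distinct_stem ps_ne by (cases ps) auto
  ultimately have "h = hd ps" using Nil.prems(2) ps_ne by (cases ps) auto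
  then show ?case using Nil \<open>v = j\<close> by simp
next
  case (snoc p xs)
  obtain m where m: "observe G v = (v, m)" "dom m = nbrs v" by (rule observe_nbrs)
  have n: "nbrs v = insert p (set (take 1 ys))"
    using nbrs_stem[of xs p v ys] snoc.prems(1) by simp
  have d: "distinct (p # v # ys)" using distinct_stem unfolding snoc.prems(1) by auto
  then have "v \<notin> set (take 1 ys)" "p \<notin> set (take 1 ys)" by (auto dest: in_set_takeD)
  then have "nbrs v - {h} = {p}" using snoc.prems(2) n d by auto
  moreover have "card (nbrs v) \<noteq> 3" unfolding n by (cases ys) (auto simp: card_insert_if)
  ultimately have "decide b (Up h q) (observe G v) = (Up v (v # q), [p])" using m by simp
  moreover have "{v, p} \<in> edges G"
    using stem_path_edges[of "xs" "[p, v]" ys] snoc.prems(1) by (simp add: insert_commute)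
  moreover have "run b G (Up v (v # q)) p (rev xs @ ws)"
    using snoc.IH[of p "v # ys" v "v # q"] snoc.prems d by (cases xs) auto
  ultimately have "run b G (Up h q) v (p # rev xs @ ws)" by (rule run_step)
  then show ?case by simp
qed


section \<open>Explored arcs of the cycle\<close>

text \<open>The last three conditions compare the excess \<open>E\<close> with the weights known so far; they are what
  makes the final cost competitive with going once around, with avoiding the edge beyond the other
  end, and with avoiding an edge of the explored arc, respectively.\<close>
definition arc_inv ::
  "'v \<Rightarrow> 'v list \<Rightarrow> 'v list \<Rightarrow> 'v list \<Rightarrow> real \<Rightarrow> real \<Rightarrow> real \<Rightarrow> real \<Rightarrow> bool" where
  "arc_inv v rs ls ys a r l E \<longleftrightarrow>
    ring (v # glue rs ls @ ys) \<and> rs \<noteq> [] \<and> ls \<noteq> [] \<and> last rs = last ls \<and>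
    a = weight G {hd ls, hd (ys @ [v])} \<and> r = walk_cost G (v # rs) \<and> l = walk_cost G ls \<and>
    E \<le> (sqrt 3 - 1) * (l + a) \<and> E \<le> 2 * l + (sqrt 3 - 1) * r \<and>
    (\<forall>e \<in> path_edges (v # rs) \<union> path_edges ls. E + weight G e \<le> sqrt 3 * (r + l + a - weight G e))"

lemma ring_edge: "ring zs \<Longrightarrow> e \<in> path_edges zs \<or> e = {last zs, hd zs} \<Longrightarrow> e \<in> edges G"
  using cycle_edges_def[of zs] by (auto simp: ring_def edges)

lemma arc_inv_edges:
  assumes "arc_inv v rs ls ys a r l E"
  shows "path_edges (v # rs) \<subseteq> edges G" "path_edges ls \<subseteq> edges G" "{hd ls, hd (ys @ [v])} \<in> edges G"
    "set rs \<subseteq> set cs" "set ls \<subseteq> set cs"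
proof -
  have ring: "ring (glue (v # rs) ls @ ys)" and ne: "v # rs \<noteq> []" "ls \<noteq> []" "last (v # rs) = last ls"
    using assms by (auto simp: arc_inv_def glue_Cons[symmetric])
  have sub: "path_edges (glue (v # rs) ls) \<subseteq> edges G"
    using ring_edge[OF ring] path_edges_infix[of "glue (v # rs) ls" "[]" ys] by auto
  then show "path_edges (v # rs) \<subseteq> edges G" "path_edges ls \<subseteq> edges G"
    using path_edges_glue[OF ne] by auto
  have g: "glue (v # rs) ls \<noteq> []" "hd (glue (v # rs) ls) = v" by (auto simp: glue_def)
  show "{hd ls, hd (ys @ [v])} \<in> edges G"
  proof (cases "ys = []")
    case True
    then show ?thesis using ring_edge[OF ring, of "{hd ls, v}"] last_glue[OF ne] g by simp
  next
    case False
    then show ?thesis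
      using ring_edge[OF ring, of "{hd ls, hd ys}"] last_glue[OF ne] g by (simp add: path_edges_append)
  qed
  show "set rs \<subseteq> set cs" "set ls \<subseteq> set cs"
    using ring set_glue[OF ne] by (auto simp: ring_def)
qed

lemma arc_inv_nonneg:
  assumes "arc_inv v rs ls ys a r l E"
  shows "0 \<le> r" "0 \<le> l" "0 \<le> a"
proof -
  have w: "0 \<le> weight G e" if "e \<in> edges G" for e using pos[OF that] by simp
  show "0 \<le> r" "0 \<le> l"
    using assms arc_inv_edges[OF assms] w by (auto simp: arc_inv_def intro!: walk_cost_nonneg)
  show "0 \<le> a" using assms arc_inv_edges(3)[OF assms] w by (auto simp: arc_inv_def)
qed

text \<open>All neighbours of \<open>v\<close> but one are recognised: \<open>hd rs\<close> belongs
  to the arc, and a stem vertex is either recorded in \<open>H\<close> or not adjacent to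
  \<open>v\<close>. What remains is the next cycle vertex, which is \<open>hd ls\<close> once
  \<open>ys\<close> is empty.\<close>

lemma arc_inv_next:
  assumes "arc_inv v rs ls ys a r l E" "H = {hd ps} \<or> H = {} \<and> v \<noteq> j"
  shows "nbrs v - H - {hd rs} = {last (glue rs ls @ ys)}"
    "\<not> (H = {} \<and> card (nbrs v) = 3)"
    "{v, last (glue rs ls @ ys)} \<in> edges G"
proof -
  obtain c rs' where rs: "rs = c # rs'" using assms(1) by (cases rs) (auto simp: arc_inv_def)
  define zs where "zs = rs' @ tl (rev ls) @ ys"
  have zs: "glue rs ls @ ys = c # zs" by (simp add: glue_def rs zs_def)
  have ring: "ring (v # c # zs)" using assms(1) zs by (simp add: arc_inv_def)
  note n = ring_nbrs[OF ring]
  have v: "v \<in> set cs" and sub: "set (c # zs) \<subseteq> set cs" using ring by (auto simp: ring_def)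
  have nv: "nbrs v = {c, last zs} \<union> (if v = j then {hd ps} else {})"
    using nbrs_cycle[OF v] n(1) by simp
  have "hd ps \<notin> set cs" using dist ps_ne by (cases ps) auto
  moreover have "c \<in> set cs" "last zs \<in> set cs" using sub n(3) by auto
  ultimately have "hd ps \<noteq> c" "hd ps \<noteq> last zs" by auto
  then show "nbrs v - H - {hd rs} = {last (glue rs ls @ ys)}"
    using assms(2) n(2,3) nv zs rs by auto
  show "\<not> (H = {} \<and> card (nbrs v) = 3)" using assms(2) n(2) nv by (auto simp: card_insert_if)
  have "last zs \<in> nbrs v" using nv by auto
  then show "{v, last (glue rs ls @ ys)} \<in> edges G" using zs n(3) by (simp add: nbrs_def)
qed

lemma decide_Cyc:
  assumes "arc_inv v rs ls ys a r l E" "H = {hd ps} \<or> H = {} \<and> v \<noteq> j"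
  shows "decide b (Cyc rs ls y a r l E H k) (observe G v) =
    (let n = last (glue rs ls @ ys); c = weight G {v, n} in
       if n = hd ls then (k, if c + l \<le> r then ls else rs)
       else if E + c \<le> sqrt 3 * (r + l + a) then (Cyc (v # rs) ls y a (r + c) l E H k, [n])
       else (Cyc ls (v # rs) n c (l + a) r (E + 2 * r) H k, glue rs ls @ [y]))"
proof -
  obtain m where m: "observe G v = (v, m)" "dom m = nbrs v"
    "\<And>u. u \<in> nbrs v \<Longrightarrow> the (m u) = weight G {v, u}"
    by (rule observe_nbrs) blast
  define n where "n = last (glue rs ls @ ys)"
  have n: "nbrs v - H - {hd rs} = {n}" "\<not> (H = {} \<and> card (nbrs v) = 3)" "{v, n} \<in> edges G"
    using arc_inv_next[OF assms] unfolding n_def by blast+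
  have "the (m n) = weight G {v, n}" using m(3) n(3) by (simp add: nbrs_def)
  then show ?thesis
    using n(1,2) m(1,2) unfolding n_def[symmetric] by (cases "n = hd ls") (simp_all add: Let_def)
qed

text \<open>With \<open>ys = []\<close> the unexplored edges at the two ends coincide in the closing
  edge of weight \<open>a\<close>. Each way for an optimal tour to treat the cycle is matched by one
  condition of \<open>arc_inv\<close>.\<close>

lemma cyc_final:
  assumes inv: "arc_inv v rs ls [] a r l E"
  obtains us where
    "\<forall>b y H k. H = {hd ps} \<or> H = {} \<and> v \<noteq> j \<longrightarrow>
      decide b (Cyc rs ls y a r l E H k) (observe G v) = (k, us)"
    "us \<noteq> []" "path_edges (v # us) \<subseteq> edges G" "last us = last rs" "set us \<subseteq> set cs"
    "\<forall>X. cycle_bound X \<longrightarrow> E + r + walk_cost G (v # us) \<le> (1 + sqrt 3) / 2 * X"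
proof -
  define us where "us = (if a + l \<le> r then ls else rs)"
  have ne: "v # rs \<noteq> []" "ls \<noteq> []" "last (v # rs) = last ls" "rs \<noteq> []" "last rs = last ls"
    and ring: "ring (glue (v # rs) ls)"
    and a: "a = weight G {hd ls, v}" and r: "r = walk_cost G (v # rs)" and l: "l = walk_cost G ls"
    and E: "E \<le> (sqrt 3 - 1) * (l + a)" "E \<le> 2 * l + (sqrt 3 - 1) * r"
    and arc: "\<And>e. e \<in> path_edges (v # rs) \<union> path_edges ls \<Longrightarrow>
      E + weight G e \<le> sqrt 3 * (r + l + a - weight G e)"
    using inv by (auto simp: arc_inv_def glue_Cons[symmetric])
  have last: "last (glue rs ls) = hd ls" "last (glue (v # rs) ls) = hd ls"
    using last_glue ne by blast+
  have hd: "hd (glue (v # rs) ls) = v" by (simp add: glue_def)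
  have cost: "walk_cost G (v # us) = min (l + a) r"
    using ne a r l by (cases ls) (auto simp: us_def insert_commute)
  have C: "cycle_cost = r + l + a"
    using ring_cost[OF ring] walk_cost_glue[OF ne(1-3), of G] last(2) hd a r l by simp
  show thesis
  proof
    show "\<forall>b y H k. H = {hd ps} \<or> H = {} \<and> v \<noteq> j \<longrightarrow>
        decide b (Cyc rs ls y a r l E H k) (observe G v) = (k, us)"
      using decide_Cyc[OF inv] last(1) a by (simp add: us_def insert_commute)
    show "us \<noteq> []" "last us = last rs" using ne by (auto simp: us_def)
    have "path_edges (v # ls) \<subseteq> edges G"
      using arc_inv_edges[OF inv] ne by (cases ls) (auto simp: insert_commute)
    then show "path_edges (v # us) \<subseteq> edges G"
      using arc_inv_edges[OF inv] by (simp add: us_def)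
    show "set us \<subseteq> set cs" using arc_inv_edges[OF inv] by (simp add: us_def)
    show "\<forall>X. cycle_bound X \<longrightarrow> E + r + walk_cost G (v # us) \<le> (1 + sqrt 3) / 2 * X"
    proof (intro allI impI)
      fix X assume "cycle_bound X"
      then consider "cycle_cost \<le> X"
        | m where "m \<in> cycle_edges cs" "2 * (cycle_cost - weight G m) \<le> X"
        by (auto simp: cycle_bound_def)
      then show "E + r + walk_cost G (v # us) \<le> (1 + sqrt 3) / 2 * X"
      proof cases
        case 1
        have "E + r + walk_cost G (v # us) \<le> (1 + sqrt 3) / 2 * cycle_cost"
          using final_bound[OF E(1), of r] by (simp add: cost C add.assoc)
        also have "\<dots> \<le> (1 + sqrt 3) / 2 * X" using 1 by (intro mult_left_mono) auto
        finally show ?thesis .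
      next
        case (2 m)
        have "E + r + walk_cost G (v # us) \<le> (1 + sqrt 3) / 2 * (2 * (cycle_cost - weight G m))"
        proof -
          have half: "(1 + sqrt 3) / 2 * (2 * t) = (1 + sqrt 3) * t" for t by simp
          have "cycle_edges cs = insert {hd ls, v} (path_edges (v # rs) \<union> path_edges ls)"
            using ring path_edges_glue[OF ne(1-3)] last(2) hd
              cycle_edges_def[of "glue (v # rs) ls"] by (simp add: ring_def)
          then consider "m = {hd ls, v}" | "m \<in> path_edges (v # rs) \<union> path_edges ls"
            using 2(1) by blast
          then show ?thesis
          proof cases
            case 1
            \<comment> \<open>The tour avoids the closing edge: returning along the arc costs at
              most \<open>r\<close>, and the second bound on \<open>E\<close> applies.\<close>
            have "0 \<le> sqrt 3 * l" using arc_inv_nonneg[OF inv] by simp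
            moreover have "0 \<le> (sqrt 3 - 1) * l" using arc_inv_nonneg[OF inv] by simp
            moreover have "min (l + a) r \<le> r" by simp
            ultimately have "E + r + min (l + a) r \<le> (1 + sqrt 3) * (r + l)"
              using E(2) unfolding distrib_right distrib_left left_diff_distrib by linarith
            then show ?thesis unfolding half using 1 by (simp add: cost C a[symmetric])
          next
            case 2
            \<comment> \<open>The tour avoids an edge of the arc: returning across the closing edge
              costs at most \<open>l + a\<close>, and \<open>r + l + a\<close> is \<open>t\<close>
              plus the avoided weight.\<close>
            define t where "t = r + l + a - weight G m"
            have "E + weight G m \<le> sqrt 3 * t" using arc[OF 2] by (simp add: t_def)
            moreover have "min (l + a) r \<le> l + a" by simp
            ultimately have "E + r + min (l + a) r \<le> t + sqrt 3 * t" unfolding t_def by linarith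
            then have "E + r + min (l + a) r \<le> (1 + sqrt 3) * (r + l + a - weight G m)"
              by (simp add: t_def distrib_right)
            then show ?thesis unfolding half by (simp add: cost C)
          qed
        qed
        also have "\<dots> \<le> (1 + sqrt 3) / 2 * X" using 2 by (intro mult_left_mono) auto
        finally show ?thesis .
      qed
    qed
  qed
qed

text \<open>The list \<open>ys\<close> runs from beyond the far end round to the neighbour of
  \<open>v\<close>, so crossing the near edge removes its last element and turning round its first.
  Uniformity in \<open>b\<close>, \<open>H\<close> and \<open>k\<close> lets the step serve both
  before and after the stem vertex is identified.\<close>

lemma cyc_step:
  assumes inv: "arc_inv v rs ls ys a r l E" and ys: "ys \<noteq> []"
  obtains us v' rs' ls' ys' a' r' l' E' where
    "\<forall>b H k. H = {hd ps} \<or> H = {} \<and> v \<noteq> j \<longrightarrow>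
      decide b (Cyc rs ls (hd (ys @ [v])) a r l E H k) (observe G v)
        = (Cyc rs' ls' (hd (ys' @ [v'])) a' r' l' E' H k, us)"
    "us \<noteq> []" "last us = v'" "path_edges (v # us) \<subseteq> edges G" "set us \<subseteq> set cs"
    "arc_inv v' rs' ls' ys' a' r' l' E'" "length ys' < length ys" "set ys = insert v' (set ys')"
    "last rs' = last rs" "E' + r' = E + r + walk_cost G (v # us)"
proof -
  define n where "n = last ys"
  define c where "c = weight G {v, n}"
  have ne: "v # rs \<noteq> []" "ls \<noteq> []" "last (v # rs) = last ls" "rs \<noteq> []" "last rs = last ls"
    and ring: "ring (glue (v # rs) ls @ ys)"
    and a: "a = weight G {hd ls, hd ys}" and r: "r = walk_cost G (v # rs)" and l: "l = walk_cost G ls"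
    and E: "E \<le> (sqrt 3 - 1) * (l + a)" "E \<le> 2 * l + (sqrt 3 - 1) * r"
    and arc: "\<And>e. e \<in> path_edges (v # rs) \<union> path_edges ls \<Longrightarrow>
      E + weight G e \<le> sqrt 3 * (r + l + a - weight G e)"
    using inv ys by (auto simp: arc_inv_def glue_Cons[symmetric])
  note nonneg = arc_inv_nonneg[OF inv]
  have last: "last (glue (v # rs) ls) = hd ls" using last_glue ne by blast
  have vn: "{v, n} \<in> edges G"
    using ring_edge[OF ring, of "{v, n}"] ys by (auto simp: n_def glue_def insert_commute)
  have c0: "0 \<le> c" using pos[OF vn] by (simp add: c_def)
  have ysC: "set ys \<subseteq> set cs" using ring by (auto simp: ring_def)
  have "hd ls \<in> set (glue (v # rs) ls)" using set_glue[OF ne(1-3)] ne(2) by auto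
  moreover have "n \<in> set ys" using ys by (simp add: n_def)
  ultimately have "n \<noteq> hd ls" using ring by (auto simp: ring_def)
  then have dec: "decide b (Cyc rs ls y a r l E H k) (observe G v) =
      (if E + c \<le> sqrt 3 * (r + l + a) then (Cyc (v # rs) ls y a (r + c) l E H k, [n])
       else (Cyc ls (v # rs) n c (l + a) r (E + 2 * r) H k, glue rs ls @ [y]))"
    if "H = {hd ps} \<or> H = {} \<and> v \<noteq> j" for b y H k
    using decide_Cyc[OF inv that] ys by (simp add: n_def c_def Let_def)
  show thesis
  proof (cases "E + c \<le> sqrt 3 * (r + l + a)")
    case True
    obtain ys' where ys': "ys = ys' @ [n]" using ys by (metis append_butlast_last_id n_def)
    have hd: "hd (ys @ [v]) = hd (ys' @ [n])" using ys' by (cases ys') auto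
    show thesis
    proof (rule that[where us="[n]" and v'=n and rs'="v # rs" and ls'=ls and ys'=ys' and a'=a
          and r'="r + c" and l'=l and E'=E])
      have "ring (n # glue (v # rs) ls @ ys')"
        using ring_rotate[of "glue (v # rs) ls @ ys'" "[n]"] ring ys' by simp
      moreover have "a = weight G {hd ls, hd (ys' @ [n])}" using a hd ys by simp
      moreover have "E \<le> 2 * l + (sqrt 3 - 1) * (r + c)"
      proof -
        have "0 \<le> (sqrt 3 - 1) * c" using c0 by simp
        then show ?thesis using E(2) by (simp add: distrib_left)
      qed
      moreover have "E + weight G e \<le> sqrt 3 * ((r + c) + l + a - weight G e)"
        if e: "e \<in> path_edges (n # v # rs) \<union> path_edges ls" for e
      proof -
        consider "e = {v, n}" | "e \<in> path_edges (v # rs) \<union> path_edges ls"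
          using e by (auto simp: insert_commute)
        then show ?thesis
        proof cases
          case 1
          \<comment> \<open>For the edge just crossed, the condition is exactly the test that
            allowed the crossing.\<close>
          then show ?thesis using True by (simp add: c_def add.assoc)
        next
          case 2
          have "0 \<le> sqrt 3 * c" using c0 by simp
          then show ?thesis using arc[OF 2] by (simp add: algebra_simps)
        qed
      qed
      ultimately show "arc_inv n (v # rs) ls ys' a (r + c) l E"
        using ne E r l by (simp add: arc_inv_def c_def insert_commute)
    qed (use dec True hd vn ys' ysC c_def ne in auto)
  next
    case False
    obtain y ys' where ys': "ys = y # ys'" using ys by (cases ys) auto
    note turn = turn_bounds[OF _ E(1) nonneg, of c]
    have hd: "hd (rev ys' @ [y]) = n" by (cases ys' rule: rev_cases) (auto simp: n_def ys')
    have us: "v # glue rs ls @ [y] = glue (v # rs) ls @ [y]" by (simp add: glue_def)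
    have g: "glue (v # rs) ls \<noteq> []" by (simp add: glue_def)
    show thesis
    proof (rule that[where us="glue rs ls @ [y]" and v'=y and rs'=ls and ls'="v # rs"
          and ys'="rev ys'" and a'=c and r'="l + a" and l'=r and E'="E + 2 * r"])
      \<comment> \<open>Turning round reverses the orientation of the listing.\<close>
      have "ring (y # glue ls (v # rs) @ rev ys')"
        using ring_rotate[of "rev ys'" "y # glue ls (v # rs)"] ring_rev[OF ring] rev_glue[OF ne(1-3)]
        by (simp add: ys')
      moreover have "l + a = walk_cost G (y # ls)"
        using ne(2) l a by (cases ls) (auto simp: ys' insert_commute)
      moreover have "E + 2 * r \<le> (sqrt 3 - 1) * (r + c)" using turn False by simp
      \<comment> \<open>The second bound on \<open>E\<close> after the turn is the first bound
        before it.\<close>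
      moreover have "E + 2 * r \<le> 2 * r + (sqrt 3 - 1) * (l + a)" using E(1) by simp
      moreover have "E + 2 * r + weight G e \<le> sqrt 3 * ((l + a) + r + c - weight G e)"
        if e: "e \<in> path_edges (y # ls) \<union> path_edges (v # rs)" for e
      proof -
        have t: "3 * r + sqrt 3 * (l + a) \<le> sqrt 3 * c" using turn False by simp
        have la: "0 \<le> sqrt 3 * (l + a)" "0 \<le> sqrt 3 * r" using nonneg by auto
        consider "e = {hd ls, hd ys}" | "e \<in> path_edges (v # rs) \<union> path_edges ls"
          using e ne(2) by (cases ls) (auto simp: ys' insert_commute)
        then show ?thesis
        proof cases
          case 1
          \<comment> \<open>The edge crossed by the turn has weight \<open>a\<close>. Its bound
            rests on the weight \<open>c\<close> left behind, through
            \<open>sqrt 3 * (l + a) + 3 * r \<le> sqrt 3 * c\<close>.\<close>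
          have "E + a \<le> sqrt 3 * (l + a)" using E(1) nonneg by (simp add: algebra_simps)
          then have "E + 2 * r + a \<le> sqrt 3 * c" using t nonneg by linarith
          moreover have "0 \<le> sqrt 3 * (l + r)" using nonneg by simp
          ultimately show ?thesis using 1 a by (simp add: algebra_simps)
        next
          case 2
          \<comment> \<open>For older edges the turn adds \<open>2 * r\<close> on the left and
            \<open>sqrt 3 * c\<close> on the right, and the latter is at least
            \<open>3 * r\<close>.\<close>
          have "sqrt 3 * ((l + a) + r + c - weight G e)
              = sqrt 3 * (r + l + a - weight G e) + sqrt 3 * c" by (simp add: algebra_simps)
          then show ?thesis using arc[OF 2] t la nonneg by linarith
        qed
      qed
      ultimately show "arc_inv y ls (v # rs) (rev ys') c (l + a) r (E + 2 * r)"
        using ne r l hd by (simp add: arc_inv_def c_def Un_commute)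
      show "path_edges (v # glue rs ls @ [y]) \<subseteq> edges G"
        unfolding us using arc_inv_edges[OF inv] path_edges_glue[OF ne(1-3)] last g ys'
        by (simp add: path_edges_append)
      show "set (glue rs ls @ [y]) \<subseteq> set cs"
        using set_glue[of rs ls] arc_inv_edges[OF inv] ne ysC ys' by auto
      show "(E + 2 * r) + (l + a) = E + r + walk_cost G (v # glue rs ls @ [y])"
        unfolding us using walk_cost_glue[OF ne(1-3), of G] last g r l a ys'
        by (simp add: walk_cost_append)
    qed (use dec False hd ys' ne in auto)
  qed
qed


section \<open>Complete runs on the cycle\<close>

lemma run_Cyc:
  assumes "arc_inv v rs ls ys a r l E" "run b G k (last rs) ws'"
  shows "\<exists>ws. run b G (Cyc rs ls (hd (ys @ [v])) a r l E {hd ps} k) v (ws @ ws') \<and>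
    ws \<noteq> [] \<and> last ws = last rs \<and> set ys \<subseteq> set ws \<and> set ws \<subseteq> set cs \<and>
    (\<forall>X. cycle_bound X \<longrightarrow> E + r + walk_cost G (v # ws) \<le> (1 + sqrt 3) / 2 * X)"
  using assms
\<comment> \<open>Every step leaves fewer unexplored vertices, and the spending \<open>E + r\<close>
  telescopes along the walk.\<close>
proof (induction "length ys" arbitrary: v rs ls ys a r l E rule: less_induct)
  case less
  show ?case
  proof (cases "ys = []")
    case True
    then have inv: "arc_inv v rs ls [] a r l E" using less.prems(1) by simp
    obtain us where us:
      "\<forall>b y H k. H = {hd ps} \<or> H = {} \<and> v \<noteq> j \<longrightarrow>
        decide b (Cyc rs ls y a r l E H k) (observe G v) = (k, us)"
      "us \<noteq> []" "path_edges (v # us) \<subseteq> edges G" "last us = last rs" "set us \<subseteq> set cs"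
      "\<forall>X. cycle_bound X \<longrightarrow> E + r + walk_cost G (v # us) \<le> (1 + sqrt 3) / 2 * X"
      using cyc_final[OF inv] .
    have "run b G (Cyc rs ls (hd (ys @ [v])) a r l E {hd ps} k) v (us @ ws')"
      by (rule run.go[OF us(1)[rule_format]]) (use us less.prems(2) in auto)
    then show ?thesis using us True by auto
  next
    case False
    obtain us v' rs' ls' ys' a' r' l' E' where us:
      "\<forall>b H k. H = {hd ps} \<or> H = {} \<and> v \<noteq> j \<longrightarrow>
        decide b (Cyc rs ls (hd (ys @ [v])) a r l E H k) (observe G v)
          = (Cyc rs' ls' (hd (ys' @ [v'])) a' r' l' E' H k, us)"
      "us \<noteq> []" "last us = v'" "path_edges (v # us) \<subseteq> edges G" "set us \<subseteq> set cs"
      "arc_inv v' rs' ls' ys' a' r' l' E'" "length ys' < length ys" "set ys = insert v' (set ys')"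
      "last rs' = last rs" "E' + r' = E + r + walk_cost G (v # us)"
      using cyc_step[OF less.prems(1) False] .
    obtain ws where ws: "run b G (Cyc rs' ls' (hd (ys' @ [v'])) a' r' l' E' {hd ps} k) v' (ws @ ws')"
      "ws \<noteq> []" "last ws = last rs" "set ys' \<subseteq> set ws" "set ws \<subseteq> set cs"
      "\<And>X. cycle_bound X \<Longrightarrow> E' + r' + walk_cost G (v' # ws) \<le> (1 + sqrt 3) / 2 * X"
      using less.hyps[OF us(7,6)] less.prems(2) us(9) by metis
    have "run b G (Cyc rs ls (hd (ys @ [v])) a r l E {hd ps} k) v (us @ ws @ ws')"
      by (rule run.go[OF us(1)[rule_format]]) (use us ws in auto)
    moreover have "v' \<in> set us" using us(2,3) by auto
    moreover have "walk_cost G (v # us @ ws) = walk_cost G (v # us) + walk_cost G (v' # ws)"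
      using walk_cost_Cons_join[OF us(2), of G v ws] us(3) by simp
    then have "E + r + walk_cost G (v # us @ ws) = E' + r' + walk_cost G (v' # ws)"
      using us(10) by simp
    ultimately show ?thesis
      using us(5,8) ws by (intro exI[of _ "us @ ws"]) auto
  qed
qed

lemma run_stem_trip:
  assumes "decide b k (observe G t) = (Down [t] k', [hd ys])" "j # ps = xs @ t # ys" "ys \<noteq> []"
    "run b G k' t ws"
  shows "run b G k t (ys @ rev (butlast ys) @ t # ws)"
proof -
  obtain u ys' where ys: "ys = u # ys'" using assms(3) by (cases ys) auto
  have "{t, u} \<in> edges G" using stem_path_edges[of xs "[t, u]" ys'] assms(2) ys by simp
  moreover have "run b G (Down [t] k') u (ys' @ rev (butlast (u # ys')) @ [t] @ ws)"
    using run_Down[of "[t]" xs u ys'] assms(2,4) ys by simp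
  ultimately have "run b G k t (u # ys' @ rev (butlast (u # ys')) @ [t] @ ws)"
    using run_step[of b k G t "Down [t] k'" u] assms(1) ys by simp
  then show ?thesis by (simp add: ys)
qed

text \<open>Up to the junction no decision depends on the second bit, so it can be fixed by the
  situation found there. The stem trip inserted at the junction returns to it and leaves the arc and
  \<open>E\<close> unchanged.\<close>

lemma run_Cyc_with_stem:
  assumes "arc_inv v rs ls ys a r l E" "j \<in> set (v # ys)"
  shows "\<exists>c ws. run [False, c] G (Cyc rs ls (hd (ys @ [v])) a r l E {} (Ret [])) v ws \<and>
    ws \<noteq> [] \<and> last ws = last rs \<and> set ys \<union> set ps \<subseteq> set ws \<and> set ws \<subseteq> verts G \<and>
    (\<forall>X. cycle_bound X \<longrightarrow>
      E + r + walk_cost G (v # ws) \<le> (1 + sqrt 3) / 2 * X + 2 * stem_cost)"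
  using assms
proof (induction "length ys" arbitrary: v rs ls ys a r l E rule: less_induct)
  case less
  show ?case
  proof (cases "v = j")
    case True
    note next_v = arc_inv_next[OF less.prems(1)]
    define h where "h = hd ps"
    define S where "S = nbrs v - {hd rs}"
    have "h \<in> set ps" using ps_ne by (simp add: h_def)
    then have h: "h \<notin> set cs" using dist by auto
    have rs: "rs \<noteq> []" using less.prems(1) by (simp add: arc_inv_def)
    then have hd_rs: "hd rs \<in> set cs"
      using arc_inv_edges(4)[OF less.prems(1)] hd_in_set[of rs] by blast
    have "h \<in> nbrs v" using nbrs_cycle[OF j] True by (simp add: h_def)
    then have hS: "h \<in> S" using h hd_rs by (auto simp: S_def)
    have Sh: "S - {h} = {last (glue rs ls @ ys)}"
      using next_v(1)[where H="{h}"] unfolding S_def h_def by blast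
    have "finite (S - {h})" unfolding Sh by simp
    then have fin: "finite S" by simp
    have "card S = Suc (card (S - {h}))" using fin hS by (rule card.remove)
    then have card_S: "card S = 2" unfolding Sh by simp
    have "path_edges (v # rs) \<subseteq> edges G" by (rule arc_inv_edges(1)[OF less.prems(1)])
    then have "hd rs \<in> nbrs v" using rs by (cases rs) (simp_all add: nbrs_def)
    moreover have "finite (nbrs v)" using fin by (simp add: S_def)
    ultimately have "card (nbrs v) = Suc (card S)" unfolding S_def by (rule card.remove[rotated])
    then have card3: "card (nbrs v) = 3" using card_S by simp
    obtain i where i: "i < 2" "enum S ! i = h" using enum_nth[OF fin hS] unfolding card_S .
    \<comment> \<open>Besides the known \<open>hd rs\<close>, the junction has two candidates for
      the stem vertex; the second bit is the position of the right one.\<close>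
    define b where "b = [False, i = 1]"
    have bits: "bits b mod 2 = i" using i(1) by (auto simp: b_def bits_def)
    let ?C = "Cyc rs ls (hd (ys @ [v])) a r l E"
    obtain m where m: "observe G v = (v, m)" "dom m = nbrs v" by (rule observe_nbrs)
    have dec: "decide b (?C {} (Ret [])) (observe G v) = (Down [v] (?C {h} (Ret [])), [h])"
      using m card3 bits i(2) by (simp add: S_def)
    have "run b G (Ret []) (last rs) []" by (rule run.halt[where k'="Ret []"]) simp
    from run_Cyc[OF less.prems(1) this] obtain ws where ws:
      "run b G (?C {h} (Ret [])) v ws"
      "ws \<noteq> []" "last ws = last rs" "set ys \<subseteq> set ws" "set ws \<subseteq> set cs"
      "\<And>X. cycle_bound X \<Longrightarrow> E + r + walk_cost G (v # ws) \<le> (1 + sqrt 3) / 2 * X"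
      unfolding h_def append_Nil2 by blast
    have "run b G (?C {} (Ret [])) v (ps @ rev (butlast ps) @ v # ws)"
      using run_stem_trip[OF dec[unfolded h_def] _ ps_ne, where xs="[]"] ws(1) True by (simp add: h_def)
    moreover have "walk_cost G (v # ps @ rev (butlast ps) @ v # ws)
        = 2 * stem_cost + walk_cost G (v # ws)"
      using walk_cost_there_and_back[OF ps_ne, of G v ws] True by (simp add: stem_cost_def)
    moreover have "set (butlast ps) \<subseteq> set ps" by (auto dest: in_set_butlastD)
    then have "set (ps @ rev (butlast ps) @ v # ws) \<subseteq> verts G"
      using ws(5) True j by (auto simp: verts)
    moreover have "set ys \<union> set ps \<subseteq> set (ps @ rev (butlast ps) @ v # ws)"
      using ws(4) by auto
    moreover have "E + r + walk_cost G (v # ps @ rev (butlast ps) @ v # ws)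
        \<le> (1 + sqrt 3) / 2 * X + 2 * stem_cost" if "cycle_bound X" for X
      using ws(6)[OF that] calculation(2) by linarith
    ultimately show ?thesis
      using ws(2,3) unfolding b_def
      by (intro exI[of _ "i = 1"] exI[of _ "ps @ rev (butlast ps) @ v # ws"]) simp
  next
    case False
    then have ys: "ys \<noteq> []" using less.prems(2) by auto
    obtain us v' rs' ls' ys' a' r' l' E' where us:
      "\<forall>b H k. H = {hd ps} \<or> H = {} \<and> v \<noteq> j \<longrightarrow>
        decide b (Cyc rs ls (hd (ys @ [v])) a r l E H k) (observe G v)
          = (Cyc rs' ls' (hd (ys' @ [v'])) a' r' l' E' H k, us)"
      "us \<noteq> []" "last us = v'" "path_edges (v # us) \<subseteq> edges G" "set us \<subseteq> set cs"
      "arc_inv v' rs' ls' ys' a' r' l' E'" "length ys' < length ys" "set ys = insert v' (set ys')"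
      "last rs' = last rs" "E' + r' = E + r + walk_cost G (v # us)"
      using cyc_step[OF less.prems(1) ys] .
    have "j \<in> set (v' # ys')" using less.prems(2) False us(8) by auto
    from less.hyps[OF us(7,6) this] obtain c ws where ws:
      "run [False, c] G (Cyc rs' ls' (hd (ys' @ [v'])) a' r' l' E' {} (Ret [])) v' ws"
      "ws \<noteq> []" "last ws = last rs" "set ys' \<union> set ps \<subseteq> set ws" "set ws \<subseteq> verts G"
      "\<And>X. cycle_bound X \<Longrightarrow>
        E' + r' + walk_cost G (v' # ws) \<le> (1 + sqrt 3) / 2 * X + 2 * stem_cost"
      using us(9) by metis
    have "run [False, c] G (Cyc rs ls (hd (ys @ [v])) a r l E {} (Ret [])) v (us @ ws)"
      by (rule run.go[OF us(1)[rule_format]]) (use us ws False in auto)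
    moreover have "v' \<in> set us" using us(2,3) by auto
    moreover have "walk_cost G (v # us @ ws) = walk_cost G (v # us) + walk_cost G (v' # ws)"
      using walk_cost_Cons_join[OF us(2), of G v ws] us(3) by simp
    then have "E + r + walk_cost G (v # us @ ws) = E' + r' + walk_cost G (v' # ws)"
      using us(10) by simp
    ultimately show ?thesis
      using us(5,8) ws by (intro exI[of _ c] exI[of _ "us @ ws"]) (auto simp: verts)
  qed
qed

text \<open>Establishes the invariant for the arc consisting of the first edge, with excess 0 and
  the far end still at the base.\<close>

lemma cyc_start:
  assumes v: "v \<in> set cs" and H: "nbrs v - H = {u. {v, u} \<in> cycle_edges cs}"
  obtains x ys a where
    "\<forall>k. cyc_start (observe G v) H k = (Cyc [v] [v] (hd (ys @ [x])) a (weight G {v, x}) 0 0 H k, [x])"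
    "arc_inv x [v] [v] ys a (weight G {v, x}) 0 0" "{v, x} \<in> edges G" "set cs = {v, x} \<union> set ys"
proof -
  obtain xs ys where "cs = xs @ v # ys" using v by (meson split_list)
  then have "ring (v # ys @ xs)" using ring_rotate[of xs "v # ys"] ring_cs by simp
  moreover obtain c zs where zs: "ys @ xs = c # zs"
    using ring_length[OF calculation] by (cases "ys @ xs") auto
  ultimately have ring: "ring (v # c # zs)" by simp
  note n = ring_nbrs[OF ring]
  obtain m where m: "observe G v = (v, m)" "dom m = nbrs v"
    "\<And>u. u \<in> nbrs v \<Longrightarrow> the (m u) = weight G {v, u}"
    by (rule observe_nbrs) blast
  let ?P = "\<lambda>(x, y). dom m - H = {x, y} \<and> x \<noteq> y \<and> the (m x) \<le> the (m y)"
  obtain x y where xy: "(SOME p. ?P p) = (x, y)" by (cases "SOME p. ?P p")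
  have dom: "dom m - H = {c, last zs}" using H n(1) m(2) by simp
  have "?P (c, last zs) \<or> ?P (last zs, c)" using dom n(2) by auto
  then have "?P (x, y)" unfolding xy[symmetric] by (rule disjE) (erule someI)+
  then have P: "{x, y} = {c, last zs}" "x \<noteq> y" "the (m x) \<le> the (m y)"
    using dom by simp_all
  have start: "cyc_start (observe G v) H k = (Cyc [v] [v] y (the (m y)) (the (m x)) 0 0 H k, [x])" for k
    unfolding cyc_start_def m(1) Let_def by (simp add: xy)
  have "x \<in> nbrs v" "y \<in> nbrs v" using P(1) dom m(2) by auto
  then have w: "the (m x) = weight G {v, x}" "the (m y) = weight G {v, y}"
    "{v, x} \<in> edges G" "{v, y} \<in> edges G"
    using m(3) by (auto simp: nbrs_def)
  \<comment> \<open>The direction of the listing is chosen so that \<open>y\<close>, the other cycle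
    neighbour of \<open>v\<close>, follows \<open>v\<close>.\<close>
  have "\<exists>ys. ring (x # v # ys) \<and> ys \<noteq> [] \<and> hd ys = y"
  proof (cases "x = c")
    case True
    then have "y = last zs" using P(1,2) by (auto simp: doubleton_eq_iff)
    moreover have "ring ([c, v] @ rev zs)"
      using ring_rotate[of "rev zs" "[c, v]"] ring_rev[OF ring] by simp
    ultimately show ?thesis using True n(3) by (intro exI[of _ "rev zs"]) (auto simp: hd_rev)
  next
    case False
    then have x: "x = last zs" "y = c" using P(1) by (auto simp: doubleton_eq_iff)
    moreover have "v # c # zs = (v # c # butlast zs) @ [x]" using n(3) x by simp
    ultimately have "ring ([x] @ v # c # butlast zs)" using ring_rotate ring by metis
    then show ?thesis using x by (intro exI[of _ "c # butlast zs"]) auto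
  qed
  then obtain us where us: "ring (x # v # us)" "us \<noteq> []" "hd us = y" by blast
  have pos': "0 < weight G {v, x}" "0 < weight G {v, y}" using pos w by auto
  \<comment> \<open>The choice of the lighter edge enters here: the condition on edges of the arc
    reads \<open>weight G {v, x} \<le> sqrt 3 * weight G {v, y}\<close>.\<close>
  have "1 * weight G {v, y} \<le> sqrt 3 * weight G {v, y}"
    using pos' by (intro mult_right_mono) auto
  then have "weight G {v, x} \<le> sqrt 3 * weight G {v, y}" using P(3) w by simp
  then have "arc_inv x [v] [v] us (weight G {v, y}) (weight G {v, x}) 0 0"
    using us pos' by (simp add: arc_inv_def glue_def insert_commute)
  moreover have "set cs = {v, x} \<union> set us" using us(1) by (auto simp: ring_def)
  ultimately show thesis using that[of us x "weight G {v, y}"] start us w by simp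
qed


section \<open>Choice of the advice and comparison with the optimum\<close>

definition good_advice :: "'v \<Rightarrow> bool list \<Rightarrow> 'v list \<Rightarrow> bool" where
  "good_advice s b ws \<longleftrightarrow> length b = 2 \<and> run b G Start s ws \<and> last (s # ws) = s \<and>
    set (s # ws) = verts G \<and>
    (\<forall>X. cycle_bound X \<longrightarrow> walk_cost G (s # ws) \<le> (1 + sqrt 3) / 2 * X + 2 * stem_cost)"

lemma good_advice_on_cycle:
  assumes "s \<in> set cs" "s \<noteq> j"
  shows "\<exists>b ws. good_advice s b ws"
proof -
  have nb: "nbrs s - {} = {u. {s, u} \<in> cycle_edges cs}" using nbrs_cycle[OF assms(1)] assms(2) by simp
  obtain x ys a where x:
    "\<forall>k. cyc_start (observe G s) {} k = (Cyc [s] [s] (hd (ys @ [x])) a (weight G {s, x}) 0 0 {} k, [x])"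
    "arc_inv x [s] [s] ys a (weight G {s, x}) 0 0" "{s, x} \<in> edges G" "set cs = {s, x} \<union> set ys"
    using cyc_start[OF assms(1) nb] .
  have "j \<in> set (x # ys)" using x(4) j assms(2) by auto
  from run_Cyc_with_stem[OF x(2) this] obtain c ws where ws:
    "run [False, c] G (Cyc [s] [s] (hd (ys @ [x])) a (weight G {s, x}) 0 0 {} (Ret [])) x ws"
    "ws \<noteq> []" "last ws = last [s]" "set ys \<union> set ps \<subseteq> set ws" "set ws \<subseteq> verts G"
    "\<forall>X. cycle_bound X \<longrightarrow>
      0 + weight G {s, x} + walk_cost G (x # ws) \<le> (1 + sqrt 3) / 2 * X + 2 * stem_cost"
    by blast
  have "card (nbrs s) = 2"
  proof -
    have "ring (s # ys @ [x])"
      using x(2) ring_rotate[of "[x]" "s # ys"] by (simp add: arc_inv_def glue_def)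
    moreover obtain y ys' where "ys @ [x] = y # ys'" by (cases ys) auto
    ultimately have "ring (s # y # ys')" by simp
    from ring_nbrs[OF this] show ?thesis using nb by simp
  qed
  moreover obtain m where m: "observe G s = (s, m)" "dom m = nbrs s" by (rule observe_nbrs)
  ultimately have "decide [False, c] Start (observe G s) = cyc_start (observe G s) {} (Ret [])"
    by simp
  then have "run [False, c] G Start s (x # ws)"
    using run_step[OF _ x(3) ws(1)] x(1) by simp
  moreover have "set (s # x # ws) = verts G" using ws(4,5) x(4) by (auto simp: verts)
  ultimately have "good_advice s [False, c] (x # ws)"
    using ws by (simp add: good_advice_def)
  then show ?thesis by blast
qed

lemma run_Ret:
  assumes "path_edges (v # q) \<subseteq> edges G"
  shows "run b G (Ret q) v q"
proof (cases "q = []")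
  case True
  then show ?thesis using run.halt[of b "Ret []" G v "Ret []"] by simp
next
  case False
  have "run b G (Ret []) (last q) []" by (rule run.halt[where k'="Ret []"]) simp
  from run.go[OF _ False assms this, of "Ret q"] show ?thesis by simp
qed

lemma run_cong: "run b G k v ws \<Longrightarrow> decide b k' (observe G v) = decide b k (observe G v) \<Longrightarrow> run b G k' v ws"
  by (cases rule: run.cases) (auto intro: run.intros)

lemma junction_nbrs: "card (nbrs j) = 3" "hd ps \<in> nbrs j" "nbrs j - {hd ps} = {u. {j, u} \<in> cycle_edges cs}"
proof -
  obtain xs ys where "cs = xs @ j # ys" using j by (meson split_list)
  then have "ring (j # ys @ xs)" using ring_rotate[of xs "j # ys"] ring_cs by simp
  moreover obtain c zs where "ys @ xs = c # zs"
    using ring_length[OF calculation] by (cases "ys @ xs") auto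
  ultimately have ring: "ring (j # c # zs)" by simp
  note n = ring_nbrs[OF ring]
  have "hd ps \<in> set ps" using ps_ne by simp
  then have "hd ps \<notin> set cs" using dist by auto
  moreover have "c \<in> set cs" "last zs \<in> set cs" using ring n(3) by (auto simp: ring_def)
  ultimately have "hd ps \<noteq> c" "hd ps \<noteq> last zs" by auto
  moreover have "nbrs j = {c, last zs, hd ps}" using nbrs_cycle[OF j] n(1) by auto
  ultimately show "card (nbrs j) = 3" "hd ps \<in> nbrs j"
    "nbrs j - {hd ps} = {u. {j, u} \<in> cycle_edges cs}"
    using n(1,2) by auto
qed

text \<open>The junction becomes the base vertex, so the cycle part closes there and
  \<open>q\<close> leads on to the start.\<close>

lemma run_from_junction:
  assumes "path_edges (j # q) \<subseteq> edges G"
  obtains ws where "run b G (Up (hd ps) q) j (ws @ q)" "ws \<noteq> []" "last ws = j" "set (j # ws) = set cs"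
    "\<And>X. cycle_bound X \<Longrightarrow> walk_cost G (j # ws) \<le> (1 + sqrt 3) / 2 * X"
proof -
  obtain x ys a where x:
    "\<forall>k. cyc_start (observe G j) {hd ps} k
      = (Cyc [j] [j] (hd (ys @ [x])) a (weight G {j, x}) 0 0 {hd ps} k, [x])"
    "arc_inv x [j] [j] ys a (weight G {j, x}) 0 0" "{j, x} \<in> edges G" "set cs = {j, x} \<union> set ys"
    using cyc_start[OF j junction_nbrs(3)] .
  have "run b G (Ret q) (last [j]) q" using run_Ret[OF assms] by simp
  from run_Cyc[OF x(2) this] obtain ws where ws:
    "run b G (Cyc [j] [j] (hd (ys @ [x])) a (weight G {j, x}) 0 0 {hd ps} (Ret q)) x (ws @ q)"
    "ws \<noteq> []" "last ws = last [j]" "set ys \<subseteq> set ws" "set ws \<subseteq> set cs"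
    "\<forall>X. cycle_bound X \<longrightarrow> 0 + weight G {j, x} + walk_cost G (x # ws) \<le> (1 + sqrt 3) / 2 * X"
    by blast
  obtain m where m: "observe G j = (j, m)" "dom m = nbrs j" by (rule observe_nbrs)
  then have "decide b (Up (hd ps) q) (observe G j) = cyc_start (observe G j) {hd ps} (Ret q)"
    using junction_nbrs(1) by simp
  then have "run b G (Up (hd ps) q) j ((x # ws) @ q)"
    using run_step[OF _ x(3) ws(1)] x(1) by simp
  moreover have "walk_cost G (j # x # ws) \<le> (1 + sqrt 3) / 2 * X" if "cycle_bound X" for X
    using ws(6) that by simp
  moreover have "set (j # x # ws) = set cs" using ws(4,5) x(4) by auto
  ultimately show thesis using ws(2,3) by (intro that[of "x # ws"]) simp_all
qed

text \<open>The start splits the stem into an inner part \<open>j # q\<close> and an outer part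
  \<open>s # ys\<close>. The outer part is toured first, then the inner part is walked inwards and,
  after the cycle, outwards. The junction itself is the case \<open>xs = []\<close>.\<close>

lemma good_advice_on_stem:
  assumes "s \<in> set (j # ps)"
  shows "\<exists>b ws. good_advice s b ws"
proof -
  obtain xs ys where split: "j # ps = xs @ s # ys" using assms by (meson split_list)
  then have split': "j # ps = (xs @ [s]) @ ys" by simp
  define q where "q = tl (xs @ [s])"
  have q: "j # q = xs @ [s]" using split by (cases xs) (auto simp: q_def)
  have stem: "stem_cost = walk_cost G (j # q) + walk_cost G (s # ys)"
    using walk_cost_join[of "xs @ [s]" G ys] unfolding stem_cost_def split' q by simp
  have "path_edges (j # q) \<subseteq> edges G" using stem_path_edges[of "[]" "xs @ [s]" ys] q split by simp
  note junction = run_from_junction[OF this]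
  \<comment> \<open>At the leaf there is no outer neighbour. The value \<open>s\<close> discards
    nothing, so \<open>Up s []\<close> decides there just as \<open>Start\<close> does.\<close>
  define h where "h = (if ys = [] then s else hd ys)"
  have "distinct (s # ys)" using distinct_stem unfolding split by auto
  then have h: "set (take 1 ys) - {s} = {h} - {s}" by (cases ys) (auto simp: h_def)
  have up: "\<exists>ws. run b G (Up h []) s ws \<and> last (s # ws) = s \<and> set (s # ws) = set cs \<union> set xs \<union> {s} \<and>
      (\<forall>X. cycle_bound X \<longrightarrow>
        walk_cost G (s # ws) \<le> (1 + sqrt 3) / 2 * X + 2 * walk_cost G (j # q))" for b
  proof -
    obtain ws where ws: "run b G (Up (hd ps) q) j (ws @ q)" "ws \<noteq> []" "last ws = j"
      "set (j # ws) = set cs"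
      "\<And>X. cycle_bound X \<Longrightarrow> walk_cost G (j # ws) \<le> (1 + sqrt 3) / 2 * X"
      using junction by blast
    have "run b G (Up h []) s (rev xs @ ws @ q)"
      using run_Up[OF split h, of b "[]" "ws @ q"] ws(1) by (simp add: q_def)
    moreover have rev: "s # rev xs = rev (j # q)" by (simp add: q)
    have "last (s # rev xs) = j" "walk_cost G (s # rev xs) = walk_cost G (j # q)"
      unfolding rev by (simp, rule walk_cost_rev)
    then have "walk_cost G (s # rev xs @ ws @ q) = walk_cost G (j # q) + walk_cost G (j # ws @ q)"
      using walk_cost_join[of "s # rev xs" G "ws @ q"] by (simp only: append_Cons) simp
    then have "walk_cost G (s # rev xs @ ws @ q) = walk_cost G (j # ws) + 2 * walk_cost G (j # q)"
      using walk_cost_Cons_join[OF ws(2), of G j q] ws(3) by simp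
    moreover have "last (s # rev xs @ ws @ q) = s"
    proof (cases "q = []")
      case True
      then have "j = s" using q by (cases xs) auto
      then show ?thesis using True ws(2,3) by simp
    next
      case False
      then have "last q = last (j # q)" by simp
      then show ?thesis using False by (simp add: q)
    qed
    moreover have "set q \<union> {j} = set xs \<union> {s}" using arg_cong[OF q, of set] by auto
    then have "set (s # rev xs @ ws @ q) = set cs \<union> set xs \<union> {s}" using ws(4) j by auto
    ultimately show ?thesis using ws(5) by (intro exI[of _ "rev xs @ ws @ q"]) simp
  qed
  obtain m where m: "observe G s = (s, m)" "dom m = nbrs s" by (rule observe_nbrs)
  have sets: "set cs \<union> set xs \<union> {s} \<union> set ys = verts G"
    using arg_cong[OF split, of set] j by (auto simp: verts)
  show ?thesis
  proof (cases "ys = []")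
    case True
    have "xs \<noteq> []" using split True ps_ne by auto
    then obtain xs' p where "xs = xs' @ [p]" by (cases xs rule: rev_cases) auto
    then have nb: "nbrs s = {p}" "p \<noteq> s"
      using nbrs_stem[of xs' p s ys] split True distinct_stem by auto
    \<comment> \<open>Any two bits serve here, as a leaf is recognised by its degree.\<close>
    obtain ws where ws: "run [True, True] G (Up h []) s ws" "last (s # ws) = s"
      "set (s # ws) = set cs \<union> set xs \<union> {s}"
      "\<And>X. cycle_bound X \<Longrightarrow>
        walk_cost G (s # ws) \<le> (1 + sqrt 3) / 2 * X + 2 * walk_cost G (j # q)"
      using up[of "[True, True]"] by blast
    have "decide [True, True] Start (observe G s) = decide [True, True] (Up h []) (observe G s)"
      using m nb True by (simp add: h_def)
    then have "run [True, True] G Start s ws" by (rule run_cong[OF ws(1)])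
    then have "good_advice s [True, True] ws"
      using ws sets stem True by (simp add: good_advice_def)
    then show ?thesis by blast
  next
    case False
    then have hd: "h = hd ys" by (simp add: h_def)
    have h_nb: "h \<in> nbrs s" and card: "finite (nbrs s)" "card (nbrs s) = 2 \<or> card (nbrs s) = 3"
    proof -
      obtain u ys' where ys: "ys = u # ys'" using False by (cases ys) auto
      have "h \<in> nbrs s \<and> finite (nbrs s) \<and> (card (nbrs s) = 2 \<or> card (nbrs s) = 3)"
      proof (cases xs rule: rev_cases)
        case Nil
        then have "s = j" "ys = ps" using split by auto
        moreover have "finite (nbrs j)" using junction_nbrs(1) card.infinite[of "nbrs j"] by linarith
        ultimately show ?thesis using junction_nbrs(1,2) hd by simp
      next
        case (snoc xs' p)
        have "nbrs s = {p, u}" using nbrs_stem[of xs' p s ys] split snoc ys by simp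
        moreover have "p \<noteq> u" using distinct_stem unfolding split snoc ys by auto
        ultimately show ?thesis using hd ys by simp
      qed
      then show "h \<in> nbrs s" "finite (nbrs s)" "card (nbrs s) = 2 \<or> card (nbrs s) = 3" by auto
    qed
    obtain i where i: "i < card (nbrs s)" "enum (nbrs s) ! i = h" using enum_nth[OF card(1) h_nb] .
    \<comment> \<open>For degree 2 the first bit marks the stem and the second is the position
      \<open>i\<close>; for degree 3 the two bits are \<open>i\<close> in binary.\<close>
    define b where "b = [card (nbrs s) = 2 \<or> i = 2, i = 1]"
    have "bits b mod card (nbrs s) = i" "card (nbrs s) = 2 \<longrightarrow> b ! 0"
      using card(2) i(1) by (auto simp: b_def bits_def)
    then have dec: "decide b Start (observe G s) = (Down [s] (Up h []), [hd ys])"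
      using m card(2) i(2) hd by (auto simp: Let_def)
    obtain ws where ws: "run b G (Up h []) s ws" "last (s # ws) = s"
      "set (s # ws) = set cs \<union> set xs \<union> {s}"
      "\<And>X. cycle_bound X \<Longrightarrow>
        walk_cost G (s # ws) \<le> (1 + sqrt 3) / 2 * X + 2 * walk_cost G (j # q)"
      using up[of b] by blast
    define us where "us = ys @ rev (butlast ys) @ s # ws"
    have "run b G Start s us"
      unfolding us_def by (rule run_stem_trip[OF dec split False ws(1)])
    moreover have "walk_cost G (s # us) = 2 * walk_cost G (s # ys) + walk_cost G (s # ws)"
      unfolding us_def by (rule walk_cost_there_and_back[OF False])
    moreover have "last (s # us) = s" using ws(2) by (simp add: us_def)
    moreover have "set (s # us) = verts G"
    proof -
      have "set (butlast ys) \<subseteq> set ys" by (auto dest: in_set_butlastD)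
      then have "set (s # us) = set (s # ws) \<union> set ys" by (auto simp: us_def)
      then show ?thesis unfolding ws(3) sets .
    qed
    moreover have "walk_cost G (s # us) \<le> (1 + sqrt 3) / 2 * X + 2 * stem_cost"
      if "cycle_bound X" for X
      using ws(4)[OF that] calculation(2) stem by linarith
    ultimately have "good_advice s b us" unfolding good_advice_def by (simp add: b_def)
    then show ?thesis by blast
  qed
qed

lemma good_advice_explores:
  assumes "good_advice s b ws"
  shows "explores_with_cost_le explorer b G s ((1 + sqrt 3) / 2 * cost_opt G s)"
proof (rule run_explores)
  show run: "run b G Start s ws" and ends: "last (s # ws) = s" and all: "set (s # ws) = verts G"
    using assms by (simp_all add: good_advice_def)
  have ratio: "0 < (1 + sqrt 3) / 2" by (simp add: add_pos_pos)
  have "0 \<le> stem_cost"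
    unfolding stem_cost_def using pos by (intro walk_cost_nonneg) (auto simp: edges less_imp_le)
  moreover have "walk_cost G (s # ws) / ((1 + sqrt 3) / 2) \<le> walk_cost G w"
    if tour: "exploration_tour G s w" for w
  proof -
    obtain X where X: "cycle_bound X" "2 * stem_cost + X \<le> walk_cost G w"
      by (rule tour_lower_bound[OF tour])
    have "walk_cost G (s # ws) \<le> (1 + sqrt 3) / 2 * X + 1 * (2 * stem_cost)"
      using assms X(1) by (simp add: good_advice_def)
    \<comment> \<open>The ratio is at least 1, so it may be granted to the stem, which the searcher
      tours optimally.\<close>
    also have "\<dots> \<le> (1 + sqrt 3) / 2 * X + (1 + sqrt 3) / 2 * (2 * stem_cost)"
      using calculation sqrt3 \<open>0 \<le> stem_cost\<close> by (intro add_left_mono mult_right_mono) auto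
    also have "\<dots> = (1 + sqrt 3) / 2 * (2 * stem_cost + X)" by (simp add: distrib_left)
    also have "\<dots> \<le> (1 + sqrt 3) / 2 * walk_cost G w" using X(2) by (intro mult_left_mono) auto
    finally show ?thesis unfolding pos_divide_le_eq[OF ratio] by (simp only: mult.commute)
  qed
  \<comment> \<open>The walk of the explorer itself shows that tours exist, so the infimum is taken
    over a nonempty set.\<close>
  moreover have "exploration_tour G s (s # ws)"
    using run_path_edges[OF run] ends all by (simp add: exploration_tour_def walk_def)
  ultimately have "walk_cost G (s # ws) / ((1 + sqrt 3) / 2) \<le> cost_opt G s"
    unfolding cost_opt_def by (intro cInf_greatest) auto
  then show "walk_cost G (s # ws) \<le> (1 + sqrt 3) / 2 * cost_opt G s"
    unfolding pos_divide_le_eq[OF ratio] by (simp only: mult.commute)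
qed

end

theorem theorem3:
  "\<exists>A :: 'v explorer. \<forall>(G :: 'v wgraph) (s :: 'v).
     tadpole G \<longrightarrow> positive_weights G \<longrightarrow> s \<in> verts G \<longrightarrow>
     (\<exists>b :: bool list. length b = 2 \<and>
        explores_with_cost_le A b G s ((1 + sqrt 3) / 2 * cost_opt G s))"
proof (intro exI[of _ explorer] allI impI)
  fix G :: "'v wgraph" and s :: 'v
  assume tadpole: "tadpole G" and pos: "positive_weights G" and s: "s \<in> verts G"
  obtain cs ps j where G: "3 \<le> length cs" "1 \<le> length ps" "distinct (cs @ ps)" "j \<in> set cs"
    "verts G = set cs \<union> set ps" "edges G = cycle_edges cs \<union> path_edges ps \<union> {{j, hd ps}}"
    using tadpole unfolding tadpole_def by blast
  have ps: "ps \<noteq> []" using G(2) by auto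
  then have "edges G = cycle_edges cs \<union> path_edges (j # ps)"
    using G(6) by (cases ps) auto
  then interpret tadpole_graph G cs ps j
    using G ps pos by unfold_locales (auto simp: positive_weights_def)
  obtain b ws where "good_advice s b ws"
    using good_advice_on_cycle[of s] good_advice_on_stem[of s] s G(5) by auto
  then show "\<exists>b. length b = 2 \<and> explores_with_cost_le explorer b G s ((1 + sqrt 3) / 2 * cost_opt G s)"
    using good_advice_explores by (auto simp: good_advice_def)
qed

end
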